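(* Let $X$ be an asymptotic $\ell_1$ space and let $(z_i)\prec X$ be a basic sequence $\Delta$-stabilizing some $\gamma\in\Delta(X)$ with $0<\gamma_1<1$. Let $(e_i)$ denote the unit vector basis of $T_{\gamma_1}$. Then for all $\varepsilon>0$ there exists a normalized $(x_i)\prec(z_i)$ satisfying, for all (finitely supported) $(a_i)\subseteq\mathbb R$, $$\Big\|\sum a_ix_i\Big\|\ge\tfrac12(1-\varepsilon)\Big\|\sum a_ie_i\Big\|_{T_{\gamma_1}}.$$ Moreover, if $(y_i)_1^k\prec(x_i)$ and $m_i=\min(\operatorname{supp}(y_i))$ w.r.t. $(x_i)$, then $$\Big\|\sum_1^ky_i\Big\|\ge\tfrac12(1-\varepsilon)\Big\|\sum_1^k\|y_i\|e_{m_i}\Big\|_{T_{\gamma_1}}.$$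
   Context: Spaces are separable infinite-dimensional Banach spaces. For a basic sequence $(x_i)$, $(y_i)\prec(x_i)$ means that $(y_i)$ is a (finite or infinite) block basis of $(x_i)$; for $X$ with a given basis, $(z_i)\prec X$ means that $(z_i)$ is a block basis of that basis. Supports are taken w.r.t. the indicated basic sequence, and $x<y$ means $\max\operatorname{supp}x<\min\operatorname{supp}y$. A space $X$ with a basis $(u_i)$ is asymptotic $\ell_1$ (w.r.t. $(u_i)$) if there is $C$ such that for all $n$ and all finitely supported $u_n\le x_1<\dots<x_n$ (i.e. $n\le\min\operatorname{supp}x_1$), $\|\sum_1^nx_i\|\ge(1/C)\sum_1^n\|x_i\|$. For $0<\theta<1$, $T_\theta$ is the completion of $c_{00}$ (finitely supported real sequences) under the norm satisfying $\|x\|=\max\big(\|x\|_\infty,\ \sup\{\theta\sum_{i=1}^n\|E_ix\|:n\in\mathbb N,\ n\le E_1<\dots<E_n\}\big)$, where the $E_i$ are finite subsets of $\mathbb N$ and $E_ix$ is the restriction of $x$ to $E_i$. For finite $F,G\subseteq\mathbb N$, $F<G$ means $\max F<\min G$ (or one is empty); $F\ge n$ means $\min F\ge n$. Schreier classes: for sets $\mathcal F,\mathcal G$ of finite subsets of $\mathbb N$, $\mathcal F[\mathcal G]=\{\bigcup_1^nG_i: n\in\mathbb N, G_1<\dots<G_n, G_i\in\mathcal G, (\min G_i)_1^n\in\mathcal F\}$. $\mathcal S_0=\{\{n\}:n\in\mathbb N\}\cup\{\emptyset\}$, $\mathcal S_1=\{F:\min F\ge|F|\}\cup\{\emptyset\}$,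 $\mathcal S_{\alpha+1}=\mathcal S_1[\mathcal S_\alpha]$, and for a limit ordinal $\alpha<\omega_1$ one fixes $\alpha_n\uparrow\alpha$ and sets $\mathcal S_\alpha=\{F:\text{for some }n,\ F\in\mathcal S_{\alpha_n}\text{ and }F\ge n\}$. A finite block sequence $(y_i)_1^k\prec(x_i)$ is $\alpha$-admissible w.r.t. $(x_i)$ if $(\min\operatorname{supp}(y_i))_{i=1}^k\in\mathcal S_\alpha$. $\delta_\alpha(x_i)$ is the supremum of $\delta\ge0$ such that $\|\sum_1^ky_i\|\ge\delta\sum_1^k\|y_i\|$ for all $(y_i)_1^k\prec(x_i)$ $\alpha$-admissible w.r.t. $(x_i)$. A basic sequence $(x_i)$ $\Delta$-stabilizes $\gamma=(\gamma_\alpha)_{\alpha<\omega_1}\subseteq\mathbb R$ if there exist $\varepsilon_n\downarrow0$ so that for every $\alpha<\omega_1$ there is $m\in\mathbb N$ such that for all $n\ge m$, if $(y_i)\prec(x_i)_n^\infty$ then $|\delta_\alpha(y_i)-\gamma_\alpha|<\varepsilon_n$. $\Delta(X)$ is the set of all $\gamma$ that are $\Delta$-stabilized by some block basis of the basis of $X$. *)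

theory Defs
  imports "HOL-Analysis.Analysis" "HOL-Library.Countable_Set_Type"
begin

text \<open>Throughout, the paper's \<open>\<nat>\<close> is \<open>{1,2,...}\<close>.  A sequence \<open>(x\<^sub>i)\<close>
  is a function on \<^typ>\<open>nat\<close> of which only the values at indices \<open>i \<ge> 1\<close> matter, a coefficient
  sequence \<open>(a\<^sub>i)\<close> is a function \<open>a :: nat \<Rightarrow> real\<close> with \<open>a 0 = 0\<close>, and a finite sequence
  \<open>(y\<^sub>i)\<close>, \<open>1 \<le> i \<le> k\<close>, is a function restricted to \<open>{1..k}\<close>.\<close>

subsection \<open>The countable ordinals\<close>

typedef omega1 = "Field (cardSuc natLeq)"
proof -
  have "infinite (Field (cardSuc natLeq))"
    using cardSuc_finite[OF natLeq_Card_order] by (simp add: Field_natLeq)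
  then show "\<exists>x. x \<in> Field (cardSuc natLeq)"
    by (metis ex_in_conv finite.emptyI)
qed

instantiation omega1 :: linorder
begin

definition less_eq_omega1 :: "omega1 \<Rightarrow> omega1 \<Rightarrow> bool" where
  "\<alpha> \<le> \<beta> \<longleftrightarrow> (Rep_omega1 \<alpha>, Rep_omega1 \<beta>) \<in> cardSuc natLeq"

definition less_omega1 :: "omega1 \<Rightarrow> omega1 \<Rightarrow> bool" where
  "\<alpha> < \<beta> \<longleftrightarrow> \<alpha> \<le> \<beta> \<and> \<not> \<beta> \<le> (\<alpha>::omega1)"

lemma omega1_wo: "Well_order (cardSuc natLeq)"
  using cardSuc_Card_order[OF natLeq_Card_order] by (simp add: card_order_on_def)

instance
proof
  have lin: "Linear_order (cardSuc natLeq)"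
    using omega1_wo by (simp add: well_order_on_def)
  then have r: "refl_on (Field (cardSuc natLeq)) (cardSuc natLeq)" and t: "trans (cardSuc natLeq)"
    and a: "antisym (cardSuc natLeq)" and tot: "total_on (Field (cardSuc natLeq)) (cardSuc natLeq)"
    by (auto simp: linear_order_on_def partial_order_on_def preorder_on_def)
  fix x y z :: omega1
  show "x < y \<longleftrightarrow> x \<le> y \<and> \<not> y \<le> x" by (simp add: less_omega1_def)
  show "x \<le> x" using r Rep_omega1 by (auto simp: less_eq_omega1_def refl_on_def)
  show "x \<le> y \<Longrightarrow> y \<le> z \<Longrightarrow> x \<le> z"
    using t unfolding less_eq_omega1_def trans_def by blast
  show "x \<le> y \<Longrightarrow> y \<le> x \<Longrightarrow> x = y"
    using a unfolding less_eq_omega1_def antisym_def by (metis Rep_omega1_inject)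
  show "x \<le> y \<or> y \<le> x"
    using tot r Rep_omega1 unfolding less_eq_omega1_def total_on_def refl_on_def by metis
qed

end

instance omega1 :: wellorder
proof
  fix P :: "omega1 \<Rightarrow> bool" and a
  assume step: "\<And>x. (\<And>y. y < x \<Longrightarrow> P y) \<Longrightarrow> P x"
  have "wf (cardSuc natLeq - Id)"
    using omega1_wo by (simp add: well_order_on_def)
  then have "wf (inv_image (cardSuc natLeq - Id) Rep_omega1)" by (rule wf_inv_image)
  then show "P a"
  proof (induction a rule: wf_induct_rule)
    case (less x)
    show ?case
    proof (rule step)
      fix y assume "y < x"
      then have "(Rep_omega1 y, Rep_omega1 x) \<in> cardSuc natLeq - Id"
        by (auto simp: less_omega1_def less_eq_omega1_def Rep_omega1_inject)
      then show "P y" using less by (simp add: inv_image_def)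
    qed
  qed
qed

context
  includes cardinal_syntax
begin

lemma countable_lessThan_omega1: "countable {..<\<alpha>::omega1}"
proof -
  let ?r = "cardSuc natLeq"
  have co: "Card_order ?r" by (rule cardSuc_Card_order[OF natLeq_Card_order])
  have "|underS ?r (Rep_omega1 \<alpha>)| <o ?r"
    by (rule card_of_underS[OF co Rep_omega1])
  then have "|underS ?r (Rep_omega1 \<alpha>)| \<le>o natLeq"
    using cardSuc_ordLeq_ordLess[OF natLeq_Card_order card_of_Card_order] by blast
  then have "countable (underS ?r (Rep_omega1 \<alpha>))"
    by (simp add: countable_card_le_natLeq)
  moreover have "Rep_omega1 ` {..<\<alpha>} \<subseteq> underS ?r (Rep_omega1 \<alpha>)"
    by (auto simp: underS_def less_omega1_def less_eq_omega1_def Rep_omega1_inject)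
  ultimately have "countable (Rep_omega1 ` {..<\<alpha>})" by (rule countable_subset[rotated])
  then show ?thesis
    by (rule countable_image_inj_on) (simp add: inj_on_def Rep_omega1_inject)
qed

lemma uncountable_omega1: "uncountable (UNIV :: omega1 set)"
proof
  assume "countable (UNIV :: omega1 set)"
  then have "countable (range Rep_omega1)" by simp
  then have "countable (Field (cardSuc natLeq))"
    using type_definition.Rep_range[OF type_definition_omega1] by simp
  then have "|Field (cardSuc natLeq)| \<le>o natLeq"
    by (simp add: countable_card_le_natLeq)
  moreover have "|Field (cardSuc natLeq)| =o cardSuc natLeq"
    by (rule card_of_Field_ordIso[OF cardSuc_Card_order[OF natLeq_Card_order]])
  ultimately have "cardSuc natLeq \<le>o natLeq"
    using ordIso_symmetric ordIso_ordLeq_trans by blast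
  then show False
    using cardSuc_greater[OF natLeq_Card_order] not_ordLess_ordLeq by blast
qed

end

lemma omega1_gt_ex: "\<exists>\<beta>. \<alpha> < (\<beta>::omega1)"
proof (rule ccontr)
  assume "\<not> ?thesis"
  then have "UNIV = insert \<alpha> {..<\<alpha>}" by (auto simp: not_less order.order_iff_strict)
  then show False
    using countable_lessThan_omega1[of \<alpha>] uncountable_omega1 by (metis countable_insert)
qed

definition osucc :: "omega1 \<Rightarrow> omega1" where
  "osucc \<alpha> = (LEAST \<beta>. \<alpha> < \<beta>)"

instantiation omega1 :: "{zero, one}"
begin
definition zero_omega1 :: omega1 where "0 = (LEAST \<alpha>::omega1. True)"
definition one_omega1 :: omega1 where "1 = osucc 0"
instance ..
end

lemma zero_le_omega1 [simp]: "0 \<le> (\<alpha>::omega1)"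
  unfolding zero_omega1_def by (rule Least_le) simp

lemma less_osucc [simp]: "\<alpha> < osucc \<alpha>"
  unfolding osucc_def using omega1_gt_ex by (rule LeastI_ex)

lemma less_osucc_iff: "\<beta> < osucc \<alpha> \<longleftrightarrow> \<beta> \<le> \<alpha>"
  by (metis less_osucc not_less not_less_Least order.strict_trans2 order.strict_trans1 osucc_def leI)

lemma osucc_inject [simp]: "osucc \<alpha> = osucc \<beta> \<longleftrightarrow> \<alpha> = \<beta>"
  by (metis less_osucc less_osucc_iff order.antisym)

lemma osucc_neq_0 [simp]: "osucc \<alpha> \<noteq> 0"
  by (metis less_osucc not_less zero_le_omega1)

definition is_limit :: "omega1 \<Rightarrow> bool" where
  "is_limit \<alpha> \<longleftrightarrow> \<alpha> \<noteq> 0 \<and> (\<forall>\<beta>. \<alpha> \<noteq> osucc \<beta>)"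

text \<open>\<open>l \<alpha> n\<close> is the \<open>n\<close>-th term of the sequence \<open>\<alpha>\<^sub>n \<up> \<alpha>\<close> fixed at the limit ordinal \<open>\<alpha>\<close>.\<close>

definition fundamental_seqs :: "(omega1 \<Rightarrow> nat \<Rightarrow> omega1) \<Rightarrow> bool" where
  "fundamental_seqs l \<longleftrightarrow> (\<forall>\<alpha>. is_limit \<alpha> \<longrightarrow>
     (\<forall>n\<ge>1. l \<alpha> n < l \<alpha> (Suc n)) \<and> (\<forall>n\<ge>1. l \<alpha> n < \<alpha>) \<and> (\<forall>\<beta><\<alpha>. \<exists>n\<ge>1. \<beta> < l \<alpha> n))"

lemma fundamental_seqs_exist: "\<exists>l. fundamental_seqs l"
proof -
  have "\<exists>g. (\<forall>n\<ge>1. g n < g (Suc n)) \<and> (\<forall>n\<ge>1. g n < \<alpha>) \<and> (\<forall>\<beta><\<alpha>. \<exists>n\<ge>(1::nat). \<beta> < g n)"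
    if lim: "is_limit \<alpha>" for \<alpha>
  proof -
    have pos: "0 < \<alpha>" using lim by (simp add: is_limit_def order.not_eq_order_implies_strict)
    have sc: "osucc \<beta> < \<alpha>" if "\<beta> < \<alpha>" for \<beta>
      using lim that by (metis is_limit_def less_osucc_iff linorder_less_linear not_less)
    have ne: "{..<\<alpha>} \<noteq> {}" using pos by auto
    define f where "f = from_nat_into {..<\<alpha>}"
    have f: "f n < \<alpha>" for n using from_nat_into[OF ne, of n] by (simp add: f_def)
    have surj: "\<exists>n. f n = \<beta>" if "\<beta> < \<alpha>" for \<beta>
      using from_nat_into_surj[OF countable_lessThan_omega1, of \<beta> \<alpha>] that by (auto simp: f_def)
    define g where "g = rec_nat 0 (\<lambda>n b. osucc (max b (f n)))"
    have g0: "g 0 = 0" and gS: "g (Suc n) = osucc (max (g n) (f n))" for n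
      by (simp_all add: g_def)
    have "g n < \<alpha>" for n
      by (induction n) (auto simp: g0 gS pos sc f)
    moreover have "g n < g (Suc n)" for n by (simp add: gS less_osucc_iff)
    moreover have "f n < g (Suc n)" for n by (simp add: gS less_osucc_iff)
    ultimately show ?thesis using surj by (intro exI[of _ g]) (metis le_add1 plus_1_eq_Suc)
  qed
  then show ?thesis unfolding fundamental_seqs_def by metis
qed

subsection \<open>Schreier classes\<close>

definition set_less :: "nat set \<Rightarrow> nat set \<Rightarrow> bool" where
  "set_less F G \<longleftrightarrow> (\<forall>i\<in>F. \<forall>j\<in>G. i < j)"

text \<open>In \<open>\<F>[\<G>]\<close> the pieces \<open>G\<^sub>i\<close> are nonempty, so that \<open>min G\<^sub>i\<close> makes sense; the empty set arises as
  the union of no pieces.\<close>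

definition family_comp :: "nat set set \<Rightarrow> nat set set \<Rightarrow> nat set set" where
  "family_comp \<F> \<G> = {\<Union>i\<in>{1..n}. G i | (n::nat) G.
     (\<forall>i\<in>{1..n}. G i \<in> \<G> \<and> G i \<noteq> {}) \<and>
     (\<forall>i\<in>{1..n}. \<forall>j\<in>{1..n}. i < j \<longrightarrow> set_less (G i) (G j)) \<and>
     (\<lambda>i. Min (G i)) ` {1..n} \<in> \<F>}"

definition schreier_zero :: "nat set set" where
  "schreier_zero = {{n} | n. n \<ge> 1} \<union> {{}}"

definition schreier_one :: "nat set set" where
  "schreier_one = {F. finite F \<and> F \<noteq> {} \<and> card F \<le> Min F} \<union> {{}}"

text \<open>The conjunct \<open>l \<alpha> n < \<alpha>\<close> only serves termination: it holds whenever \<open>fundamental_seqs l\<close>.\<close>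

context
  notes conj_cong [fundef_cong]
begin

function schreier :: "(omega1 \<Rightarrow> nat \<Rightarrow> omega1) \<Rightarrow> omega1 \<Rightarrow> nat set set" where
  "schreier l \<alpha> =
     (if \<alpha> = 0 then schreier_zero
      else if \<exists>\<beta>. \<alpha> = osucc \<beta> then family_comp schreier_one (schreier l (THE \<beta>. \<alpha> = osucc \<beta>))
      else {F. \<exists>n\<ge>1. l \<alpha> n < \<alpha> \<and> F \<in> schreier l (l \<alpha> n) \<and> (\<forall>i\<in>F. n \<le> i)})"
  by pat_completeness auto
termination
  by (relation "inv_image {(a, b). a < b} snd") (auto simp: wf)

end

declare schreier.simps [simp del]

lemma schreier_0: "schreier l 0 = schreier_zero"
  by (simp add: schreier.simps)

lemma schreier_osucc: "schreier l (osucc \<alpha>) = family_comp schreier_one (schreier l \<alpha>)"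
  by (subst schreier.simps) auto

lemma schreier_limit:
  assumes "fundamental_seqs l" "is_limit \<alpha>"
  shows "schreier l \<alpha> = {F. \<exists>n\<ge>1. F \<in> schreier l (l \<alpha> n) \<and> (\<forall>i\<in>F. n \<le> i)}"
  using assms by (subst schreier.simps) (auto simp: is_limit_def fundamental_seqs_def)

lemma schreier_1: "schreier l 1 = schreier_one"
proof -
  have "F \<in> schreier_one" if "F \<in> family_comp schreier_one schreier_zero" for F
  proof -
    from that obtain n G where F: "F = (\<Union>i\<in>{1..n::nat}. G i)"
      and G: "\<forall>i\<in>{1..n}. G i \<in> schreier_zero \<and> G i \<noteq> {}"
      and M: "(\<lambda>i. Min (G i)) ` {1..n} \<in> schreier_one"
      unfolding family_comp_def by blast
    have "G i = {Min (G i)}" if "i \<in> {1..n}" for i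
      using G that unfolding schreier_zero_def by fastforce
    then have "F = (\<lambda>i. Min (G i)) ` {1..n}" unfolding F by blast
    then show ?thesis using M by simp
  qed
  moreover have "F \<in> family_comp schreier_one schreier_zero" if F: "F \<in> schreier_one" for F
  proof -
    have fin: "finite F" using F by (auto simp: schreier_one_def)
    have pos: "1 \<le> i" if "i \<in> F" for i
    proof -
      have "card F \<noteq> 0" using fin that by auto
      moreover have "card F \<le> Min F" using F that by (auto simp: schreier_one_def)
      moreover have "Min F \<le> i" using fin that by simp
      ultimately show ?thesis by linarith
    qed
    define L where "L = sorted_list_of_set F"
    define g where "g i = L ! (i - 1)" for i
    have L: "set L = F" "sorted_wrt (<) L" using fin by (auto simp: L_def)
    have "g ` {1..length L} = F"
    proof -
      have "{1..length L} = Suc ` {..<length L}"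
        by (metis One_nat_def image_Suc_lessThan)
      then have "g ` {1..length L} = (!) L ` {..<length L}"
        by (simp add: g_def image_image)
      then show ?thesis using L by (auto simp: set_conv_nth)
    qed
    moreover have "g i < g j" if "i \<in> {1..length L}" "j \<in> {1..length L}" "i < j" for i j
      using that unfolding g_def by (intro sorted_wrt_nth_less[OF L(2)]) auto
    ultimately show ?thesis
      unfolding family_comp_def using F pos
      by (intro CollectI exI[of _ "length L"] exI[of _ "\<lambda>i. {g i}"])
         (auto simp: set_less_def schreier_zero_def)
  qed
  ultimately show ?thesis
    unfolding one_omega1_def schreier_osucc schreier_0 by blast
qed

subsection \<open>Bases, supports and block bases\<close>

definition expansion :: "(nat \<Rightarrow> 'a::banach) \<Rightarrow> (nat \<Rightarrow> real) \<Rightarrow> 'a \<Rightarrow> bool" where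
  "expansion x a v \<longleftrightarrow> a 0 = 0 \<and> (\<lambda>i. a i *\<^sub>R x i) sums v"

definition basic_seq :: "(nat \<Rightarrow> 'a::banach) \<Rightarrow> bool" where
  "basic_seq x \<longleftrightarrow> (\<forall>v\<in>closure (span (x ` {1..})). \<exists>!a. expansion x a v)"

definition schauder_basis :: "(nat \<Rightarrow> 'a::banach) \<Rightarrow> bool" where
  "schauder_basis x \<longleftrightarrow> (\<forall>v. \<exists>!a. expansion x a v)"

definition supp :: "(nat \<Rightarrow> 'a::banach) \<Rightarrow> 'a \<Rightarrow> nat set" where
  "supp x v = {i. (THE a. expansion x a v) i \<noteq> 0}"

text \<open>\<open>block_on x I y\<close>: \<open>(y\<^sub>i)\<close>, \<open>i \<in> I\<close>, is a block basis of \<open>(x\<^sub>i)\<close>.  The index set is \<open>{1..k}\<close>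
  for finite and \<open>{1..}\<close> for infinite block bases.\<close>

definition block_on :: "(nat \<Rightarrow> 'a::banach) \<Rightarrow> nat set \<Rightarrow> (nat \<Rightarrow> 'a) \<Rightarrow> bool" where
  "block_on x I y \<longleftrightarrow>
     (\<forall>i\<in>I. y i \<in> span (x ` {1..}) \<and> y i \<noteq> 0) \<and>
     (\<forall>i\<in>I. \<forall>j\<in>I. i < j \<longrightarrow> Max (supp x (y i)) < Min (supp x (y j)))"

abbreviation block_basis :: "(nat \<Rightarrow> 'a::banach) \<Rightarrow> (nat \<Rightarrow> 'a) \<Rightarrow> bool" where
  "block_basis x y \<equiv> block_on x {1..} y"

definition asymptotic_l1 :: "(nat \<Rightarrow> 'a::banach) \<Rightarrow> bool" where
  "asymptotic_l1 u \<longleftrightarrow> (\<exists>C>0. \<forall>n\<ge>1. \<forall>x. block_on u {1..n} x \<and> n \<le> Min (supp u (x 1)) \<longrightarrow>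
     norm (\<Sum>i=1..n. x i) \<ge> 1 / C * (\<Sum>i=1..n. norm (x i)))"

subsection \<open>The indices \<open>\<delta>\<^sub>\<alpha>\<close> and \<open>\<Delta>\<close>-stabilization\<close>

definition admissible ::
  "(omega1 \<Rightarrow> nat \<Rightarrow> omega1) \<Rightarrow> omega1 \<Rightarrow> (nat \<Rightarrow> 'a::banach) \<Rightarrow> nat \<Rightarrow> (nat \<Rightarrow> 'a) \<Rightarrow> bool" where
  "admissible l \<alpha> x k y \<longleftrightarrow>
     block_on x {1..k} y \<and> (\<lambda>i. Min (supp x (y i))) ` {1..k} \<in> schreier l \<alpha>"

definition delta :: "(omega1 \<Rightarrow> nat \<Rightarrow> omega1) \<Rightarrow> omega1 \<Rightarrow> (nat \<Rightarrow> 'a::banach) \<Rightarrow> real" where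
  "delta l \<alpha> x = Sup {d. d \<ge> 0 \<and> (\<forall>k y. admissible l \<alpha> x k y \<longrightarrow>
     norm (\<Sum>i=1..k. y i) \<ge> d * (\<Sum>i=1..k. norm (y i)))}"

text \<open>The block bases \<open>y\<close> of the tail \<open>(x\<^sub>i)\<close>, \<open>i \<ge> n\<close>, which is re-indexed from \<open>1\<close>, are infinite
  ones: a block basis of length one has \<open>\<delta>\<^sub>\<alpha> = 1\<close>.\<close>

definition Delta_stabilizes ::
  "(omega1 \<Rightarrow> nat \<Rightarrow> omega1) \<Rightarrow> (nat \<Rightarrow> 'a::banach) \<Rightarrow> (omega1 \<Rightarrow> real) \<Rightarrow> bool" where
  "Delta_stabilizes l x \<gamma> \<longleftrightarrow> basic_seq x \<and>
     (\<exists>\<epsilon>. decseq \<epsilon> \<and> \<epsilon> \<longlonglongrightarrow> 0 \<and>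
       (\<forall>\<alpha>. \<exists>m\<ge>1. \<forall>n\<ge>m. \<forall>y. block_basis (\<lambda>i. x (i + n - 1)) y \<longrightarrow>
          \<bar>delta l \<alpha> y - \<gamma> \<alpha>\<bar> < \<epsilon> n))"

definition Delta :: "(omega1 \<Rightarrow> nat \<Rightarrow> omega1) \<Rightarrow> (nat \<Rightarrow> 'a::banach) \<Rightarrow> (omega1 \<Rightarrow> real) set" where
  "Delta l u = {\<gamma>. \<exists>x. block_basis u x \<and> Delta_stabilizes l x \<gamma>}"

subsection \<open>The norm of \<open>T\<^sub>\<theta>\<close> on \<open>c\<^sub>0\<^sub>0\<close>\<close>

definition c00 :: "(nat \<Rightarrow> real) set" where
  "c00 = {a. finite {i. a i \<noteq> 0} \<and> a 0 = 0}"

definition unit_vec :: "nat \<Rightarrow> nat \<Rightarrow> real" where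
  "unit_vec m = (\<lambda>j. if j = m then 1 else 0)"

definition restr :: "nat set \<Rightarrow> (nat \<Rightarrow> real) \<Rightarrow> nat \<Rightarrow> real" where
  "restr E a = (\<lambda>i. if i \<in> E then a i else 0)"

text \<open>\<open>n \<le> E\<^sub>1 < \<dots> < E\<^sub>n\<close> for nonempty finite sets (were \<open>E\<^sub>1 = {}\<close> allowed, \<open>n \<le> E\<^sub>1\<close> would not
  constrain the other sets).\<close>

definition tsirelson_adm :: "nat \<Rightarrow> (nat \<Rightarrow> nat set) \<Rightarrow> bool" where
  "tsirelson_adm n E \<longleftrightarrow> n \<ge> 1 \<and> (\<forall>i\<in>{1..n}. finite (E i) \<and> E i \<noteq> {}) \<and> n \<le> Min (E 1) \<and>
     (\<forall>i\<in>{1..n}. \<forall>j\<in>{1..n}. i < j \<longrightarrow> set_less (E i) (E j))"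

definition tsirelson_set :: "real \<Rightarrow> ((nat \<Rightarrow> real) \<Rightarrow> real) \<Rightarrow> (nat \<Rightarrow> real) \<Rightarrow> real set" where
  "tsirelson_set \<theta> N a = {\<theta> * (\<Sum>i=1..n. N (restr (E i) a)) | n E. tsirelson_adm n E}"

definition norm_on_c00 :: "((nat \<Rightarrow> real) \<Rightarrow> real) \<Rightarrow> bool" where
  "norm_on_c00 N \<longleftrightarrow>
     (\<forall>a\<in>c00. N a \<ge> 0 \<and> (N a = 0 \<longleftrightarrow> a = (\<lambda>i. 0))) \<and>
     (\<forall>a\<in>c00. \<forall>t. N (\<lambda>i. t * a i) = \<bar>t\<bar> * N a) \<and>
     (\<forall>a\<in>c00. \<forall>b\<in>c00. N (\<lambda>i. a i + b i) \<le> N a + N b)"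

definition is_tsirelson_norm :: "real \<Rightarrow> ((nat \<Rightarrow> real) \<Rightarrow> real) \<Rightarrow> bool" where
  "is_tsirelson_norm \<theta> N \<longleftrightarrow> norm_on_c00 N \<and>
     (\<forall>a\<in>c00. bdd_above (tsirelson_set \<theta> N a) \<and>
        N a = max (SUP i. \<bar>a i\<bar>) (Sup (tsirelson_set \<theta> N a)))"

text \<open>Only the values on \<open>c\<^sub>0\<^sub>0\<close> matter, and there the choice is unique: see
  \<open>tsirelson_norm_exists\<close> and \<open>tsirelson_norm_unique\<close> below.\<close>

definition tsirelson_norm :: "real \<Rightarrow> (nat \<Rightarrow> real) \<Rightarrow> real" where
  "tsirelson_norm \<theta> = (SOME N. is_tsirelson_norm \<theta> N)"

lemma restr_c00: "a \<in> c00 \<Longrightarrow> restr E a \<in> c00"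
  unfolding c00_def restr_def by (auto elim: finite_subset[rotated])

lemma scale_c00: "a \<in> c00 \<Longrightarrow> (\<lambda>i. t * a i) \<in> c00"
  unfolding c00_def by (auto elim: finite_subset[rotated])

lemma add_c00: "a \<in> c00 \<Longrightarrow> b \<in> c00 \<Longrightarrow> (\<lambda>i. a i + b i) \<in> c00"
  unfolding c00_def
  by (auto intro: finite_subset[of _ "{i. a i \<noteq> 0} \<union> {i. b i \<noteq> 0}"])

lemma finite_range_c00: "a \<in> c00 \<Longrightarrow> finite (range (\<lambda>i. \<bar>a i\<bar>))"
proof -
  assume a: "a \<in> c00"
  have "range (\<lambda>i. \<bar>a i\<bar>) \<subseteq> insert 0 ((\<lambda>i. \<bar>a i\<bar>) ` {i. a i \<noteq> 0})" by auto
  then show ?thesis using a by (auto simp: c00_def intro: finite_subset)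
qed

lemma sup_upper: "a \<in> c00 \<Longrightarrow> \<bar>a i\<bar> \<le> (SUP i. \<bar>a i\<bar>)"
  by (rule cSUP_upper) (auto intro: bdd_above_finite finite_range_c00)

lemma tsirelson_adm_1: "tsirelson_adm 1 (\<lambda>_. {1})"
  by (simp add: tsirelson_adm_def)

lemma tsirelson_set_ne: "tsirelson_set \<theta> N a \<noteq> {}"
  unfolding tsirelson_set_def using tsirelson_adm_1 by blast

definition l1_sum :: "(nat \<Rightarrow> real) \<Rightarrow> real" where
  "l1_sum a = (\<Sum>i | a i \<noteq> 0. \<bar>a i\<bar>)"

lemma l1_restr_sum:
  assumes a: "a \<in> c00" and E: "tsirelson_adm n E"
  shows "(\<Sum>i=1..n. l1_sum (restr (E i) a)) \<le> l1_sum a"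
proof -
  let ?S = "{i. a i \<noteq> 0}"
  have fin: "finite ?S" using a by (simp add: c00_def)
  have l: "l1_sum (restr A a) = (\<Sum>i\<in>A \<inter> ?S. \<bar>a i\<bar>)" for A
    unfolding l1_sum_def restr_def by (rule sum.cong) auto
  have disj: "E i \<inter> ?S \<inter> (E j \<inter> ?S) = {}" if "i \<in> {1..n}" "j \<in> {1..n}" "i \<noteq> j" for i j
  proof -
    have "set_less (E i) (E j) \<or> set_less (E j) (E i)"
      using E that unfolding tsirelson_adm_def by (metis nat_neq_iff)
    then show ?thesis unfolding set_less_def by blast
  qed
  have "(\<Sum>i=1..n. l1_sum (restr (E i) a)) = (\<Sum>i\<in>{1..n}. \<Sum>j\<in>E i \<inter> ?S. \<bar>a j\<bar>)"
    by (simp add: l)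
  also have "\<dots> = (\<Sum>j\<in>(\<Union>i\<in>{1..n}. E i \<inter> ?S). \<bar>a j\<bar>)"
    by (rule sum.UNION_disjoint[symmetric]) (use fin disj in auto)
  also have "\<dots> \<le> (\<Sum>j\<in>?S. \<bar>a j\<bar>)"
    by (rule sum_mono2) (use fin in auto)
  finally show ?thesis by (simp add: l1_sum_def)
qed

definition subl1_seminorm :: "((nat \<Rightarrow> real) \<Rightarrow> real) \<Rightarrow> bool" where
  "subl1_seminorm p \<longleftrightarrow> (\<forall>a\<in>c00. 0 \<le> p a \<and> p a \<le> l1_sum a) \<and>
     (\<forall>a\<in>c00. \<forall>t. p (\<lambda>i. t * a i) \<le> \<bar>t\<bar> * p a) \<and>
     (\<forall>a\<in>c00. \<forall>b\<in>c00. p (\<lambda>i. a i + b i) \<le> p a + p b)"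

definition tsirelson_step :: "real \<Rightarrow> ((nat \<Rightarrow> real) \<Rightarrow> real) \<Rightarrow> (nat \<Rightarrow> real) \<Rightarrow> real" where
  "tsirelson_step \<theta> p a = max (SUP i. \<bar>a i\<bar>) (Sup (tsirelson_set \<theta> p a))"

lemma tsirelson_set_le_l1:
  assumes p: "subl1_seminorm p" and a: "a \<in> c00" and \<theta>: "0 < \<theta>" "\<theta> < 1"
    and r: "r \<in> tsirelson_set \<theta> p a"
  shows "r \<le> l1_sum a"
proof -
  from r obtain n E where E: "tsirelson_adm n E"
    and r: "r = \<theta> * (\<Sum>i=1..n. p (restr (E i) a))"
    unfolding tsirelson_set_def by blast
  have "(\<Sum>i=1..n. p (restr (E i) a)) \<le> (\<Sum>i=1..n. l1_sum (restr (E i) a))"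
    by (rule sum_mono) (use p a restr_c00 in \<open>auto simp: subl1_seminorm_def\<close>)
  also have "\<dots> \<le> l1_sum a" by (rule l1_restr_sum[OF a E])
  finally have 1: "(\<Sum>i=1..n. p (restr (E i) a)) \<le> l1_sum a" .
  have 2: "0 \<le> (\<Sum>i=1..n. p (restr (E i) a))"
    by (rule sum_nonneg) (use p a restr_c00 in \<open>auto simp: subl1_seminorm_def\<close>)
  have "r \<le> 1 * (\<Sum>i=1..n. p (restr (E i) a))"
    unfolding r by (rule mult_right_mono) (use \<theta> 2 in auto)
  then show ?thesis using 1 by simp
qed

lemma tsirelson_set_bdd:
  assumes "subl1_seminorm p" "a \<in> c00" "0 < \<theta>" "\<theta> < 1"
  shows "bdd_above (tsirelson_set \<theta> p a)"
  using tsirelson_set_le_l1[OF assms] by (rule bdd_aboveI)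

lemma tsirelson_step_upper:
  assumes "subl1_seminorm p" "a \<in> c00" "0 < \<theta>" "\<theta> < 1" "tsirelson_adm n E"
  shows "\<theta> * (\<Sum>i=1..n. p (restr (E i) a)) \<le> tsirelson_step \<theta> p a"
proof -
  have "\<theta> * (\<Sum>i=1..n. p (restr (E i) a)) \<in> tsirelson_set \<theta> p a"
    using assms(5) unfolding tsirelson_set_def by blast
  then show ?thesis
    unfolding tsirelson_step_def using cSup_upper[OF _ tsirelson_set_bdd[OF assms(1-4)]]
    by (simp add: le_max_iff_disj)
qed

lemma tsirelson_step_least:
  assumes "\<And>i. \<bar>a i\<bar> \<le> r"
    and "\<And>n E. tsirelson_adm n E \<Longrightarrow> \<theta> * (\<Sum>i=1..n. p (restr (E i) a)) \<le> r"
  shows "tsirelson_step \<theta> p a \<le> r"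
  unfolding tsirelson_step_def
proof (rule max.boundedI)
  show "(SUP i. \<bar>a i\<bar>) \<le> r" by (rule cSUP_least) (use assms(1) in auto)
  show "Sup (tsirelson_set \<theta> p a) \<le> r"
    by (rule cSup_least[OF tsirelson_set_ne]) (use assms(2) in \<open>auto simp: tsirelson_set_def\<close>)
qed

lemma abs_le_tsirelson_step: "a \<in> c00 \<Longrightarrow> \<bar>a i\<bar> \<le> tsirelson_step \<theta> p a"
  unfolding tsirelson_step_def using sup_upper[of a i] by (simp add: le_max_iff_disj)

lemma abs_le_l1: "a \<in> c00 \<Longrightarrow> \<bar>a i\<bar> \<le> l1_sum a"
proof (cases "a i = 0")
  case True
  then show ?thesis by (simp add: l1_sum_def sum_nonneg)
next
  case False
  assume "a \<in> c00"
  then show ?thesis unfolding l1_sum_def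
    by (intro member_le_sum[where f="\<lambda>i. \<bar>a i\<bar>"]) (use False in \<open>auto simp: c00_def\<close>)
qed

lemma subl1_seminorm_step:
  assumes p: "subl1_seminorm p" and \<theta>: "0 < \<theta>" "\<theta> < 1"
  shows "subl1_seminorm (tsirelson_step \<theta> p)"
  unfolding subl1_seminorm_def
proof (intro conjI ballI allI)
  fix a assume a: "a \<in> c00"
  show "0 \<le> tsirelson_step \<theta> p a" using abs_le_tsirelson_step[OF a] abs_ge_zero order_trans by blast
  show "tsirelson_step \<theta> p a \<le> l1_sum a"
    by (rule tsirelson_step_least)
       (use abs_le_l1[OF a] tsirelson_set_le_l1[OF p a \<theta>] in \<open>auto simp: tsirelson_set_def\<close>)
  fix t
  show "tsirelson_step \<theta> p (\<lambda>i. t * a i) \<le> \<bar>t\<bar> * tsirelson_step \<theta> p a"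
  proof (rule tsirelson_step_least)
    fix i show "\<bar>t * a i\<bar> \<le> \<bar>t\<bar> * tsirelson_step \<theta> p a"
      using abs_le_tsirelson_step[OF a, of i] by (simp add: abs_mult mult_left_mono)
  next
    fix n E assume E: "tsirelson_adm n E"
    have "p (restr (E i) (\<lambda>i. t * a i)) \<le> \<bar>t\<bar> * p (restr (E i) a)" for i
    proof -
      have "restr (E i) (\<lambda>i. t * a i) = (\<lambda>j. t * restr (E i) a j)" by (auto simp: restr_def)
      then show ?thesis using p restr_c00[OF a] by (simp add: subl1_seminorm_def)
    qed
    then have "\<theta> * (\<Sum>i=1..n. p (restr (E i) (\<lambda>i. t * a i)))
        \<le> \<theta> * (\<Sum>i=1..n. \<bar>t\<bar> * p (restr (E i) a))"
      using \<theta> by (intro mult_left_mono sum_mono) auto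
    also have "\<dots> = \<bar>t\<bar> * (\<theta> * (\<Sum>i=1..n. p (restr (E i) a)))"
      by (simp add: sum_distrib_left algebra_simps)
    also have "\<dots> \<le> \<bar>t\<bar> * tsirelson_step \<theta> p a"
      by (intro mult_left_mono tsirelson_step_upper[OF p a \<theta> E]) simp
    finally show "\<theta> * (\<Sum>i=1..n. p (restr (E i) (\<lambda>i. t * a i))) \<le> \<bar>t\<bar> * tsirelson_step \<theta> p a" .
  qed
next
  fix a b assume a: "a \<in> c00" and b: "b \<in> c00"
  show "tsirelson_step \<theta> p (\<lambda>i. a i + b i) \<le> tsirelson_step \<theta> p a + tsirelson_step \<theta> p b"
  proof (rule tsirelson_step_least)
    fix i show "\<bar>a i + b i\<bar> \<le> tsirelson_step \<theta> p a + tsirelson_step \<theta> p b"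
      using abs_le_tsirelson_step[OF a, of i] abs_le_tsirelson_step[OF b, of i]
      by (meson abs_triangle_ineq add_mono order_trans)
  next
    fix n E assume E: "tsirelson_adm n E"
    have "p (restr (E i) (\<lambda>i. a i + b i)) \<le> p (restr (E i) a) + p (restr (E i) b)" for i
    proof -
      have "restr (E i) (\<lambda>i. a i + b i) = (\<lambda>j. restr (E i) a j + restr (E i) b j)"
        by (auto simp: restr_def)
      then show ?thesis using p restr_c00[OF a] restr_c00[OF b] by (simp add: subl1_seminorm_def)
    qed
    then have "\<theta> * (\<Sum>i=1..n. p (restr (E i) (\<lambda>i. a i + b i)))
        \<le> \<theta> * (\<Sum>i=1..n. p (restr (E i) a) + p (restr (E i) b))"
      using \<theta> by (intro mult_left_mono sum_mono) auto
    also have "\<dots> = \<theta> * (\<Sum>i=1..n. p (restr (E i) a)) + \<theta> * (\<Sum>i=1..n. p (restr (E i) b))"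
      by (simp add: sum.distrib algebra_simps)
    also have "\<dots> \<le> tsirelson_step \<theta> p a + tsirelson_step \<theta> p b"
      by (intro add_mono tsirelson_step_upper[OF p _ \<theta> E] a b)
    finally show "\<theta> * (\<Sum>i=1..n. p (restr (E i) (\<lambda>i. a i + b i)))
        \<le> tsirelson_step \<theta> p a + tsirelson_step \<theta> p b" .
  qed
qed

lemma tsirelson_step_mono:
  assumes "subl1_seminorm q" "a \<in> c00" "0 < \<theta>" "\<theta> < 1" and le: "\<And>b. b \<in> c00 \<Longrightarrow> p b \<le> q b"
  shows "tsirelson_step \<theta> p a \<le> tsirelson_step \<theta> q a"
proof (rule tsirelson_step_least)
  show "\<bar>a i\<bar> \<le> tsirelson_step \<theta> q a" for i by (rule abs_le_tsirelson_step[OF assms(2)])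
  fix n E assume E: "tsirelson_adm n E"
  have "\<theta> * (\<Sum>i=1..n. p (restr (E i) a)) \<le> \<theta> * (\<Sum>i=1..n. q (restr (E i) a))"
    using assms(3) le restr_c00[OF assms(2)] by (intro mult_left_mono sum_mono) auto
  also have "\<dots> \<le> tsirelson_step \<theta> q a" by (rule tsirelson_step_upper[OF assms(1-4) E])
  finally show "\<theta> * (\<Sum>i=1..n. p (restr (E i) a)) \<le> tsirelson_step \<theta> q a" .
qed

lemma tsirelson_norm_exists:
  assumes \<theta>: "0 < \<theta>" "\<theta> < 1"
  shows "\<exists>N. is_tsirelson_norm \<theta> N"
proof -
  define p :: "nat \<Rightarrow> (nat \<Rightarrow> real) \<Rightarrow> real"
    where "p k = (tsirelson_step \<theta> ^^ k) (\<lambda>_. 0)" for k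
  have p0: "p 0 = (\<lambda>_. 0)" and pS: "p (Suc k) = tsirelson_step \<theta> (p k)" for k
    by (simp_all add: p_def)
  have semi: "subl1_seminorm (p k)" for k
  proof (induction k)
    case 0
    show ?case by (auto simp: p0 subl1_seminorm_def l1_sum_def intro: sum_nonneg)
  next
    case (Suc k)
    then show ?case by (simp add: pS subl1_seminorm_step \<theta>)
  qed
  have mono: "p k a \<le> p (Suc k) a" if "a \<in> c00" for k a
    using that
  proof (induction k arbitrary: a)
    case 0
    then show ?case using semi[of "Suc 0"] by (simp add: p0 subl1_seminorm_def)
  next
    case (Suc k)
    have "tsirelson_step \<theta> (p k) a \<le> tsirelson_step \<theta> (p (Suc k)) a"
      by (rule tsirelson_step_mono[OF semi Suc.prems \<theta> Suc.IH])
    then show ?case by (simp add: pS)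
  qed
  define N where "N a = (SUP k. p k a)" for a
  have bdd: "bdd_above (range (\<lambda>k. p k a))" if "a \<in> c00" for a
    by (rule bdd_aboveI[of _ "l1_sum a"]) (use semi that in \<open>auto simp: subl1_seminorm_def\<close>)
  have upper: "p k a \<le> N a" if "a \<in> c00" for k a
    unfolding N_def by (rule cSUP_upper[OF _ bdd[OF that]]) simp
  have lim: "(\<lambda>k. p k a) \<longlonglongrightarrow> N a" if "a \<in> c00" for a
    unfolding N_def by (rule LIMSEQ_incseq_SUP[OF bdd[OF that]]) (simp add: incseq_SucI mono that)
  have Nsemi: "subl1_seminorm N"
    unfolding subl1_seminorm_def
  proof (intro conjI ballI allI)
    fix a assume a: "a \<in> c00"
    show "0 \<le> N a" using upper[OF a, of 0] by (simp add: p0)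
    show "N a \<le> l1_sum a"
      unfolding N_def by (rule cSUP_least) (use semi a in \<open>auto simp: subl1_seminorm_def\<close>)
    fix t
    have "p k (\<lambda>i. t * a i) \<le> \<bar>t\<bar> * N a" for k
    proof -
      have "p k (\<lambda>i. t * a i) \<le> \<bar>t\<bar> * p k a" using semi a by (simp add: subl1_seminorm_def)
      also have "\<dots> \<le> \<bar>t\<bar> * N a" by (intro mult_left_mono upper a) simp
      finally show ?thesis .
    qed
    then show "N (\<lambda>i. t * a i) \<le> \<bar>t\<bar> * N a"
      unfolding N_def[of "\<lambda>i. t * a i"] by (intro cSUP_least) auto
  next
    fix a b assume a: "a \<in> c00" and b: "b \<in> c00"
    have "p k (\<lambda>i. a i + b i) \<le> N a + N b" for k
    proof -
      have "p k (\<lambda>i. a i + b i) \<le> p k a + p k b" using semi a b by (simp add: subl1_seminorm_def)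
      also have "\<dots> \<le> N a + N b" by (intro add_mono upper a b)
      finally show ?thesis .
    qed
    then show "N (\<lambda>i. a i + b i) \<le> N a + N b"
      unfolding N_def[of "\<lambda>i. a i + b i"] by (intro cSUP_least) auto
  qed
  have fixp: "N a = tsirelson_step \<theta> N a" if a: "a \<in> c00" for a
  proof (rule antisym)
    have "p k a \<le> tsirelson_step \<theta> N a" for k
    proof (cases k)
      case 0
      then show ?thesis
        using subl1_seminorm_step[OF Nsemi \<theta>] a by (simp add: p0 subl1_seminorm_def)
    next
      case (Suc j)
      then show ?thesis
        using tsirelson_step_mono[OF Nsemi a \<theta>, of "p j"] upper by (simp add: pS)
    qed
    then show "N a \<le> tsirelson_step \<theta> N a" unfolding N_def[of a] by (intro cSUP_least) auto
    show "tsirelson_step \<theta> N a \<le> N a"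
    proof (rule tsirelson_step_least)
      fix i
      have "\<bar>a i\<bar> \<le> p 1 a" using abs_le_tsirelson_step[OF a] pS[of 0] by simp
      then show "\<bar>a i\<bar> \<le> N a" using upper[OF a, of 1] by linarith
    next
      fix n E assume E: "tsirelson_adm n E"
      have "(\<lambda>k. \<theta> * (\<Sum>i=1..n. p k (restr (E i) a))) \<longlonglongrightarrow> \<theta> * (\<Sum>i=1..n. N (restr (E i) a))"
        by (intro tendsto_intros lim restr_c00 a)
      moreover have "\<theta> * (\<Sum>i=1..n. p k (restr (E i) a)) \<le> N a" for k
        using tsirelson_step_upper[OF semi a \<theta> E, of k] upper[OF a, of "Suc k"] by (simp add: pS)
      ultimately show "\<theta> * (\<Sum>i=1..n. N (restr (E i) a)) \<le> N a"
        by (intro LIMSEQ_le_const2) auto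
    qed
  qed
  have "norm_on_c00 N"
    unfolding norm_on_c00_def
  proof (intro conjI ballI allI)
    fix a assume a: "a \<in> c00"
    show "0 \<le> N a" using Nsemi a by (simp add: subl1_seminorm_def)
    show "N a = 0 \<longleftrightarrow> a = (\<lambda>i. 0)"
    proof
      assume "N a = 0"
      then show "a = (\<lambda>i. 0)" using abs_le_tsirelson_step[OF a, of _ \<theta> N] fixp[OF a] by fastforce
    next
      assume "a = (\<lambda>i. 0)"
      moreover have "0 \<le> N a" "N a \<le> l1_sum a" using Nsemi a by (auto simp: subl1_seminorm_def)
      ultimately show "N a = 0" by (simp add: l1_sum_def)
    qed
    fix t
    have 1: "N (\<lambda>i. s * b i) \<le> \<bar>s\<bar> * N b" if "b \<in> c00" for s b
      using Nsemi that by (simp add: subl1_seminorm_def)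
    show "N (\<lambda>i. t * a i) = \<bar>t\<bar> * N a"
    proof (cases "t = 0")
      case True
      have "0 \<le> N (\<lambda>i. t * a i)" using Nsemi scale_c00[OF a] by (simp add: subl1_seminorm_def)
      then show ?thesis using 1[OF a, of t] True by simp
    next
      case False
      have "N a \<le> \<bar>1 / t\<bar> * N (\<lambda>i. t * a i)" using 1[OF scale_c00[OF a, of t], of "1 / t"] False by simp
      then have "\<bar>t\<bar> * N a \<le> N (\<lambda>i. t * a i)" using False by (simp add: field_simps)
      then show ?thesis using 1[OF a, of t] by simp
    qed
  next
    fix a b assume "a \<in> c00" "b \<in> c00"
    then show "N (\<lambda>i. a i + b i) \<le> N a + N b" using Nsemi by (simp add: subl1_seminorm_def)
  qed
  then have "is_tsirelson_norm \<theta> N"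
    unfolding is_tsirelson_norm_def
    using tsirelson_set_bdd[OF Nsemi _ \<theta>] fixp by (auto simp: tsirelson_step_def)
  then show ?thesis by blast
qed

lemma tsirelson_norm_le:
  assumes N: "is_tsirelson_norm \<theta> N" and M: "is_tsirelson_norm \<theta> M"
    and \<theta>: "0 < \<theta>" "\<theta> < 1" and "a \<in> c00"
  shows "N a \<le> M a"
  using \<open>a \<in> c00\<close>
proof (induction "card {i. a i \<noteq> 0}" arbitrary: a rule: less_induct)
  case (less a)
  note a = less.prems
  have fin: "finite {i. a i \<noteq> 0}" using a by (simp add: c00_def)
  have "(\<lambda>i. 0) \<in> c00" by (simp add: c00_def)
  then have N0: "N (\<lambda>i. 0) = 0"
    using N unfolding is_tsirelson_norm_def norm_on_c00_def by blast
  have Npos: "0 \<le> N a"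
    using N a unfolding is_tsirelson_norm_def norm_on_c00_def by blast
  have Mstep: "M b = tsirelson_step \<theta> M b" and Mbdd: "bdd_above (tsirelson_set \<theta> M b)"
    if "b \<in> c00" for b
    using M that by (auto simp: is_tsirelson_norm_def tsirelson_step_def)
  have Nstep: "N a = tsirelson_step \<theta> N a"
    using N a by (auto simp: is_tsirelson_norm_def tsirelson_step_def)
  have M1: "r \<le> M a" if "r \<in> tsirelson_set \<theta> M a" for r
    using cSup_upper[OF that Mbdd[OF a]] Mstep[OF a] by (simp add: tsirelson_step_def le_max_iff_disj)
  have "N a \<le> max (M a) (\<theta> * N a)"
    unfolding Nstep[THEN arg_cong, of "\<lambda>x. x \<le> max (M a) (\<theta> * N a)"]
  proof (rule tsirelson_step_least)
    show "\<bar>a i\<bar> \<le> max (M a) (\<theta> * N a)" for i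
      using abs_le_tsirelson_step[OF a, of i \<theta> M] Mstep[OF a] by (simp add: le_max_iff_disj)
  next
    fix n E assume E: "tsirelson_adm n E"
    show "\<theta> * (\<Sum>i=1..n. N (restr (E i) a)) \<le> max (M a) (\<theta> * N a)"
    proof (cases "\<exists>i\<in>{1..n}. restr (E i) a = a")
      case True
      then obtain i where i: "i \<in> {1..n}" "restr (E i) a = a" by blast
      have "restr (E j) a = (\<lambda>_. 0)" if j: "j \<in> {1..n}" "j \<noteq> i" for j
      proof -
        have "set_less (E i) (E j) \<or> set_less (E j) (E i)"
          using E i(1) j unfolding tsirelson_adm_def by (metis nat_neq_iff)
        then have "E i \<inter> E j = {}" unfolding set_less_def by blast
        moreover have "a k = 0" if "k \<notin> E i" for k
          using fun_cong[OF i(2), of k] that by (simp add: restr_def)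
        ultimately show ?thesis by (auto simp: restr_def fun_eq_iff)
      qed
      then have "(\<Sum>j=1..n. N (restr (E j) a)) = (\<Sum>j=1..n. if j = i then N a else 0)"
        using i(2) N0 by (intro sum.cong) auto
      also have "\<dots> = N a" using i(1) by simp
      finally show ?thesis by (simp add: le_max_iff_disj)
    next
      case False
      have "N (restr (E i) a) \<le> M (restr (E i) a)" if "i \<in> {1..n}" for i
      proof (rule less.hyps[OF _ restr_c00[OF a]])
        obtain k where "restr (E i) a k \<noteq> a k" using False \<open>i \<in> {1..n}\<close> by (meson ext)
        then have "{j. restr (E i) a j \<noteq> 0} \<subset> {j. a j \<noteq> 0}"
          by (auto simp: restr_def split: if_splits)
        then show "card {j. restr (E i) a j \<noteq> 0} < card {j. a j \<noteq> 0}"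
          by (rule psubset_card_mono[OF fin])
      qed
      then have "\<theta> * (\<Sum>i=1..n. N (restr (E i) a)) \<le> \<theta> * (\<Sum>i=1..n. M (restr (E i) a))"
        using \<theta> by (intro mult_left_mono sum_mono) auto
      also have "\<dots> \<le> M a" using E by (intro M1) (auto simp: tsirelson_set_def)
      finally show ?thesis by simp
    qed
  qed
  moreover have "M a \<ge> 0" using M a by (auto simp: is_tsirelson_norm_def norm_on_c00_def)
  moreover have "\<theta> * N a < N a" if "0 < N a" using \<theta> that by simp
  ultimately show "N a \<le> M a" using Npos by (cases "N a = 0") (auto simp: max_def split: if_splits)
qed

lemma tsirelson_norm_unique:
  assumes "is_tsirelson_norm \<theta> N" "0 < \<theta>" "\<theta> < 1" "a \<in> c00"
  shows "tsirelson_norm \<theta> a = N a"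
proof -
  have "is_tsirelson_norm \<theta> (tsirelson_norm \<theta>)"
    unfolding tsirelson_norm_def using someI[of "is_tsirelson_norm \<theta>", OF assms(1)] by simp
  then show ?thesis using assms by (intro antisym tsirelson_norm_le[of \<theta>])
qed

end

(* Write theta for gamma 1. Among the deltas only delta_1 of tails of (z_i) matters: for each
   tau < theta some tail of (z_i) satisfies a lower l_1 estimate with constant tau for k successive
   blocks starting beyond k. Choose normalized blocks x_m of (z_i) so far out that, beyond x_m, such an
   estimate holds for 2 m blocks with tau so close to theta that the product of all ratios tau / theta
   exceeds 1 - 2 e, and such that (x_m) is almost monotone (Mazur). Unfolding the implicit equation of
   the Tsirelson norm gives a tree of admissible families, whose value is compared with the norm from
   the leaves up. Two points keep the constant under control. A node whose leftmost descendant is m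
   absorbs the pieces of its first child, at most 2 m pieces in all, so the estimate at m is used only
   once and not once per level. And every set is enlarged to an interval starting at its chosen
   point m, since restricting to a subset need not be bounded; only at the root is an initial segment
   cut off, which by almost monotonicity costs the factor 2. *)
theory Submission
  imports Defs "HOL-Library.Ramsey"
begin

text \<open>Absorbing the first child is possible only if that child still offers its pieces
  uncombined. Hence the induction in \<open>tsirelson_lower_estimate\<close> carries two bounds for
  each node: one for its whole interval, with constant \<open>c m\<close>, and one for the sum over
  a family of at most m pieces of it, with the better constant \<open>c (Suc m)\<close>. The second
  bound uses no estimate at m. In a sum over the children's intervals only the first child has the
  worse constant \<open>c m\<close>, and the factor \<theta> of the node itself makes up for that,
  because \<open>\<theta> * c (Suc m) \<le> c m\<close>. This is the origin of the requirement
  \<open>2 * e \<le> 1 - \<theta>\<close>: all constants lie between 1 - 2 e and 1, so any gap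
  between \<theta> and 1 is enough once e is small. The almost monotone sequence needs normalized
  vectors that stay apart from each other. Here the lower l_1 estimate for two blocks supplies them:
  it keeps the normalized terms of a tail of (z_i) at a fixed positive distance.\<close>

section \<open>The Tsirelson norm as a tree of admissible families\<close>

text \<open>Families of successive sets are kept as sets of sets, without numbering, so that the
  pieces of one child can be united with the other children without reindexing.\<close>

definition separated :: "nat set set \<Rightarrow> bool" where
  "separated \<D> \<longleftrightarrow> (\<forall>A\<in>\<D>. \<forall>B\<in>\<D>. A \<noteq> B \<longrightarrow> set_less A B \<or> set_less B A)"

lemma separated_mono: "separated \<D> \<Longrightarrow> \<E> \<subseteq> \<D> \<Longrightarrow> separated \<E>"
  unfolding separated_def by (meson subsetD)

lemma separated_Un:
  assumes "separated \<D>" "separated \<E>" "\<And>A B. A \<in> \<D> \<Longrightarrow> B \<in> \<E> \<Longrightarrow> set_less A B"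
  shows "separated (\<D> \<union> \<E>)"
  unfolding separated_def
proof (intro ballI impI)
  fix A B assume "A \<in> \<D> \<union> \<E>" "B \<in> \<D> \<union> \<E>" "A \<noteq> B"
  then consider "A \<in> \<D>" "B \<in> \<D>" | "A \<in> \<E>" "B \<in> \<E>" | "A \<in> \<D>" "B \<in> \<E>" | "A \<in> \<E>" "B \<in> \<D>"
    by auto
  then show "set_less A B \<or> set_less B A"
    using assms \<open>A \<noteq> B\<close> by cases (simp_all add: separated_def)
qed

text \<open>The tree appears as an induction rule on \<open>card E\<close>. Values s strictly below
  the norm leave room for approximation, so no supremum has to be attained; \<open>mono\<close> lets
  the bound drop at every node.\<close>

lemma tsirelson_norm_upper_induct:
  fixes \<theta> :: real and good :: "nat set \<Rightarrow> real \<Rightarrow> bool"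
  assumes N: "is_tsirelson_norm \<theta> N" and \<theta>: "0 < \<theta>" "\<theta> < 1" and a: "a \<in> c00"
    and leaf: "\<And>E i. finite E \<Longrightarrow> i \<in> E \<Longrightarrow> good E \<bar>a i\<bar>"
    and node: "\<And>E \<D> v. finite E \<Longrightarrow> finite \<D> \<Longrightarrow> \<D> \<noteq> {} \<Longrightarrow> {} \<notin> \<D> \<Longrightarrow> separated \<D> \<Longrightarrow>
      \<Union>\<D> \<subseteq> E \<Longrightarrow> (\<And>i. i \<in> \<Union>\<D> \<Longrightarrow> card \<D> \<le> i) \<Longrightarrow>
      (\<And>D. D \<in> \<D> \<Longrightarrow> good D (v D) \<and> 0 \<le> v D) \<Longrightarrow> good E (\<theta> * (\<Sum>D\<in>\<D>. v D))"
    and mono: "\<And>E v w. good E v \<Longrightarrow> w \<le> v \<Longrightarrow> good E w"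
    and E: "finite E" "E \<noteq> {}" and s: "s < N (restr E a)"
  shows "good E s"
  using E s
proof (induction "card E" arbitrary: E s rule: less_induct)
  case (less E s)
  define b where "b = restr E a"
  have b: "b \<in> c00" unfolding b_def by (rule restr_c00[OF a])
  have Npos: "0 \<le> N x" if "x \<in> c00" for x
    using N that unfolding is_tsirelson_norm_def norm_on_c00_def by blast
  have "(\<lambda>i. 0) \<in> c00" by (simp add: c00_def)
  then have N0: "N (\<lambda>i. 0) = 0"
    using N unfolding is_tsirelson_norm_def norm_on_c00_def by blast
  have zero: "good D 0" if D: "finite D" "D \<noteq> {}" for D
  proof -
    obtain i where "i \<in> D" using D by blast
    then show ?thesis using mono[OF leaf[OF D(1)], of i 0] by simp
  qed
  show ?case
  proof (cases "s < 0 \<or> (\<exists>i\<in>E. s \<le> \<bar>a i\<bar>)")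
    case True
    then show ?thesis
    proof
      assume "s < 0"
      then show ?thesis using mono[OF zero[OF less.prems(1,2)], of s] by simp
    next
      assume "\<exists>i\<in>E. s \<le> \<bar>a i\<bar>"
      then show ?thesis using mono leaf[OF less.prems(1)] by blast
    qed
  next
    case False
    then have s0: "0 \<le> s" and sup: "\<And>i. i \<in> E \<Longrightarrow> \<bar>a i\<bar> < s" by (auto simp: not_less not_le)
    have "N b > 0" using less.prems(3) s0 by (simp add: b_def)
    \<comment> \<open>A family having E itself as a piece yields only \<theta> times the norm.
      Exceeding \<open>\<theta> * N b\<close> therefore forces all pieces to be proper subsets of E,
      and the induction on \<open>card E\<close> applies to them.\<close>
    define r where "r = max s (\<theta> * N b)"
    have r: "r < N b" "s \<le> r" "\<theta> * N b \<le> r" "0 \<le> r"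
      using less.prems(3) \<open>N b > 0\<close> \<theta> s0 by (auto simp: r_def b_def)
    have step: "N b = tsirelson_step \<theta> N b"
      using N b by (auto simp: is_tsirelson_norm_def tsirelson_step_def)
    have "\<exists>n D. tsirelson_adm n D \<and> r < \<theta> * (\<Sum>i=1..n. N (restr (D i) b))"
    proof (rule ccontr)
      assume "\<not> ?thesis"
      then have *: "\<theta> * (\<Sum>i=1..n. N (restr (D i) b)) \<le> r" if "tsirelson_adm n D" for n D
        using that by (meson not_le)
      have "\<bar>b i\<bar> \<le> r" for i
        using sup[of i] r s0 by (auto simp: b_def restr_def)
      then have "N b \<le> r" unfolding step by (rule tsirelson_step_least) (rule *)
      then show False using r by simp
    qed
    then obtain n D where D: "tsirelson_adm n D" and rD: "r < \<theta> * (\<Sum>i=1..n. N (restr (D i) b))" by blast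
    have fD: "finite (D i)" "D i \<noteq> {}" if "i \<in> {1..n}" for i
      using D that by (auto simp: tsirelson_adm_def)
    have sep: "set_less (D i) (D j) \<or> set_less (D j) (D i)" if "i \<in> {1..n}" "j \<in> {1..n}" "i \<noteq> j" for i j
      using D that unfolding tsirelson_adm_def by (metis nat_neq_iff)
    have n_le: "n \<le> p" if "i \<in> {1..n}" "p \<in> D i" for i p
    proof -
      have n1: "n \<ge> 1" "n \<le> Min (D 1)" using D by (auto simp: tsirelson_adm_def)
      have "n \<le> q" if "q \<in> D 1" for q using n1 fD[of 1] that by (meson Min_le atLeastAtMost_iff le_refl order_trans)
      moreover have "i = 1 \<or> set_less (D 1) (D i)"
        using D that n1 unfolding tsirelson_adm_def by (metis atLeastAtMost_iff le_refl nless_le)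
      ultimately show ?thesis using that fD(2)[of 1] n1 unfolding set_less_def
        by (metis atLeastAtMost_iff equals0I le_refl less_imp_le order_trans)
    qed
    \<comment> \<open>Pieces are cut down to E and those missing E are dropped, as they contribute
      0. This makes the pieces nonempty subsets of E and can only lower their number.\<close>
    define I where "I = {i\<in>{1..n}. D i \<inter> E \<noteq> {}}"
    define \<D> where "\<D> = (\<lambda>i. D i \<inter> E) ` I"
    have inj: "inj_on (\<lambda>i. D i \<inter> E) I"
    proof (rule inj_onI, rule ccontr)
      fix i j assume ij: "i \<in> I" "j \<in> I" "D i \<inter> E = D j \<inter> E" "i \<noteq> j"
      then obtain p where "p \<in> D i" "p \<in> D j" unfolding I_def by blast
      then show False using sep[of i j] ij unfolding I_def set_less_def by blast
    qed
    have eq: "restr (D i) b = restr (D i \<inter> E) a" for i by (auto simp: b_def restr_def)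
    have "(\<Sum>i=1..n. N (restr (D i) b)) = (\<Sum>i\<in>I. N (restr (D i) b))"
    proof (rule sum.mono_neutral_right)
      show "\<forall>i\<in>{1..n} - I. N (restr (D i) b) = 0"
      proof
        fix i assume "i \<in> {1..n} - I"
        then have "D i \<inter> E = {}" by (simp add: I_def)
        then have "restr (D i) b = (\<lambda>_. 0)" unfolding eq by (simp add: restr_def)
        then show "N (restr (D i) b) = 0" by (simp add: N0)
      qed
    qed (auto simp: I_def)
    also have "\<dots> = (\<Sum>A\<in>\<D>. N (restr A a))"
      unfolding \<D>_def sum.reindex[OF inj] by (simp add: eq)
    finally have rD': "r < \<theta> * (\<Sum>A\<in>\<D>. N (restr A a))" using rD by simp
    have fin: "finite \<D>" by (simp add: \<D>_def I_def)
    have ne: "{} \<notin> \<D>" by (auto simp: \<D>_def I_def)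
    have nemp: "\<D> \<noteq> {}" using rD' r by auto
    have sepD: "separated \<D>"
      using sep unfolding separated_def \<D>_def I_def set_less_def by blast
    have proper: "A \<noteq> E" if "A \<in> \<D>" for A
    proof
      assume "A = E"
      have "\<D> = {E}"
      proof -
        have "B = E" if "B \<in> \<D>" for B
        proof (rule ccontr)
          assume "B \<noteq> E"
          then have "set_less B E \<or> set_less E B"
            using sepD that \<open>A \<in> \<D>\<close> \<open>A = E\<close> unfolding separated_def by blast
          moreover have "B \<subseteq> E" "B \<noteq> {}" using that ne by (auto simp: \<D>_def)
          ultimately show False unfolding set_less_def by blast
        qed
        then show ?thesis using that \<open>A = E\<close> by blast
      qed
      then show False using rD' r by (simp add: b_def)
    qed
    have card_le: "card \<D> \<le> n"
    proof -
      have "I \<subseteq> {1..n}" by (auto simp: I_def)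
      then have "finite I" "card I \<le> n" using finite_subset card_mono[of "{1..n}" I] by auto
      then show ?thesis using card_image_le[of I "\<lambda>i. D i \<inter> E"] by (simp add: \<D>_def)
    qed
    \<comment> \<open>The excess of the sum over \<open>r / \<theta>\<close> is shared equally: each
      piece is used at its norm minus t, strictly below the norm, and these values still add up to
      \<open>r / \<theta>\<close>.\<close>
    define t where "t = ((\<Sum>A\<in>\<D>. N (restr A a)) - r / \<theta>) / card \<D>"
    have cpos: "0 < real (card \<D>)" using fin nemp by (simp add: card_gt_0_iff)
    have tpos: "0 < t" using rD' \<theta> cpos by (simp add: t_def field_simps)
    define v where "v A = max 0 (N (restr A a) - t)" for A
    have gv: "good A (v A) \<and> 0 \<le> v A" if A: "A \<in> \<D>" for A
    proof -
      have sub: "A \<subset> E" using proper[OF A] A by (auto simp: \<D>_def)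
      have fA: "finite A" "A \<noteq> {}" using sub less.prems(1) finite_subset ne A by auto
      have "good A (N (restr A a) - t)"
        by (rule less.hyps[OF psubset_card_mono[OF less.prems(1) sub] fA]) (use tpos in simp)
      then show ?thesis using zero[OF fA] by (auto simp: v_def max_def)
    qed
    have "good E (\<theta> * (\<Sum>A\<in>\<D>. v A))"
    proof (rule node[OF less.prems(1) fin nemp ne sepD _ _ gv])
      show "\<Union> \<D> \<subseteq> E" by (auto simp: \<D>_def)
      fix p assume "p \<in> \<Union>\<D>"
      then show "card \<D> \<le> p" using n_le card_le by (fastforce simp: \<D>_def I_def)
    qed
    moreover have "s \<le> \<theta> * (\<Sum>A\<in>\<D>. v A)"
    proof -
      have "(\<Sum>A\<in>\<D>. N (restr A a) - t) \<le> (\<Sum>A\<in>\<D>. v A)" by (rule sum_mono) (simp add: v_def)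
      moreover have "(\<Sum>A\<in>\<D>. N (restr A a) - t) = r / \<theta>"
        using cpos by (simp add: sum_subtractf t_def)
      ultimately show ?thesis using r \<theta> by (simp add: field_simps)
    qed
    ultimately show ?thesis by (rule mono)
  qed
qed

section \<open>Comparing a tree with a set function\<close>

text \<open>The loss is charged to indices and not to levels of the tree: whatever its depth, a tree
  with leftmost chosen index m keeps the fraction \<open>c m\<close> of its value.
  \<open>f_node\<close> has the form of a ratio \<open>c m / c (Suc m)\<close> so that it cancels
  against the constant of the absorbed pieces.\<close>

lemma tsirelson_lower_estimate:
  fixes f :: "nat set \<Rightarrow> real" and c :: "nat \<Rightarrow> real"
  assumes N: "is_tsirelson_norm \<theta> N" and \<theta>: "0 < \<theta>" "\<theta> < 1" and a: "a \<in> c00"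
    and S: "finite S" "S \<subseteq> {1..}" "S \<noteq> {}" "{i. a i \<noteq> 0} \<subseteq> S"
    and c: "incseq c" "\<And>m. 0 \<le> c m" "\<And>m. \<theta> * c (Suc m) \<le> c m"
    and f_leaf: "\<And>I m n. I \<subseteq> S \<Longrightarrow> m \<in> I \<Longrightarrow> (\<And>i. i \<in> I \<Longrightarrow> m \<le> i) \<Longrightarrow> c n * \<bar>a m\<bar> \<le> f I"
    and f_node: "\<And>\<E> m. finite \<E> \<Longrightarrow> separated \<E> \<Longrightarrow> \<Union>\<E> \<subseteq> S \<inter> {m..} \<Longrightarrow> 1 \<le> m \<Longrightarrow> card \<E> \<le> 2 * m \<Longrightarrow>
      c m * \<theta> * (\<Sum>E\<in>\<E>. f E) \<le> c (Suc m) * f (\<Union>\<E>)"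
    and s: "s < N a"
  shows "\<exists>m\<in>S. c m * s \<le> f (S \<inter> {m..})"
proof -
  \<comment> \<open>The second conjunct is what a parent absorbs if this node is its first child;
    the estimate at m has not yet been spent there, hence \<open>c (Suc m)\<close>.\<close>
  define P where "P m I v \<longleftrightarrow> c m * v \<le> f I \<and>
      (\<exists>\<E>. finite \<E> \<and> separated \<E> \<and> \<Union>\<E> = I \<and> card \<E> \<le> m \<and> c (Suc m) * v \<le> (\<Sum>E\<in>\<E>. f E))" for m I v
  \<comment> \<open>The choice of m depends on the node alone, whereas I is left open: the parent
    decides later how far the interval extends, as long as it starts at m and contains the rest of
    E. Points of E before m are given up.\<close>
  define good where "good E v \<longleftrightarrow> (E \<subseteq> S \<longrightarrow> (\<exists>m\<in>E. \<forall>I. I \<subseteq> S \<and> m \<in> I \<and> (\<forall>i\<in>I. m \<le> i) \<and> E \<inter> {m..} \<subseteq> I \<longrightarrow> P m I v))" for E v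
  have "good S s"
  proof (rule tsirelson_norm_upper_induct[OF N \<theta> a, where good = good])
    fix E and i :: nat assume "finite E" "i \<in> E"
    have "P i I \<bar>a i\<bar>" if "I \<subseteq> S" "i \<in> I" "\<forall>j\<in>I. i \<le> j" for I
    proof -
      have "1 \<le> i" using that S by auto
      then have "finite {I} \<and> separated {I} \<and> \<Union>{I} = I \<and> card {I} \<le> i \<and> c (Suc i) * \<bar>a i\<bar> \<le> (\<Sum>E\<in>{I}. f E)"
        using f_leaf[of I i "Suc i"] that by (auto simp: separated_def)
      then show ?thesis unfolding P_def using f_leaf[of I i i] that by blast
    qed
    then show "good E \<bar>a i\<bar>" unfolding good_def using \<open>i \<in> E\<close> by blast
  next
    fix E v w assume g: "good E v" and wv: "w \<le> v"
    have cw: "c k * w \<le> c k * v" for k by (rule mult_left_mono[OF wv c(2)])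
    have "P m I w" if "P m I v" for m I
      using that order_trans[OF cw] unfolding P_def by blast
    then have imp: "(Q \<longrightarrow> P m I v) \<longrightarrow> (Q \<longrightarrow> P m I w)" for m I Q by simp
    show "good E w"
      unfolding good_def
    proof
      assume "E \<subseteq> S"
      then obtain m where "m \<in> E" and
        m: "\<forall>I. I \<subseteq> S \<and> m \<in> I \<and> (\<forall>i\<in>I. m \<le> i) \<and> E \<inter> {m..} \<subseteq> I \<longrightarrow> P m I v"
        using g unfolding good_def by auto
      then show "\<exists>m\<in>E. \<forall>I. I \<subseteq> S \<and> m \<in> I \<and> (\<forall>i\<in>I. m \<le> i) \<and> E \<inter> {m..} \<subseteq> I \<longrightarrow> P m I w"
        by (intro bexI[of _ m] allI imp[THEN mp]) auto
    qed
  next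
    fix E \<D> v
    assume fE: "finite E" and fD: "finite \<D>" and nD: "\<D> \<noteq> {}" and neD: "{} \<notin> \<D>" and sep: "separated \<D>"
      and sub: "\<Union>\<D> \<subseteq> E" and card: "\<And>i. i \<in> \<Union>\<D> \<Longrightarrow> card \<D> \<le> i"
      and g: "\<And>D. D \<in> \<D> \<Longrightarrow> good D (v D) \<and> 0 \<le> v D"
    show "good E (\<theta> * (\<Sum>D\<in>\<D>. v D))"
      unfolding good_def
    proof
      assume ES: "E \<subseteq> S"
      have "\<forall>D\<in>\<D>. \<exists>m\<in>D. \<forall>I. I \<subseteq> S \<and> m \<in> I \<and> (\<forall>i\<in>I. m \<le> i) \<and> D \<inter> {m..} \<subseteq> I \<longrightarrow> P m I (v D)"
      proof
        fix D assume D: "D \<in> \<D>"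
        then have "D \<subseteq> S" using sub ES by blast
        then show "\<exists>m\<in>D. \<forall>I. I \<subseteq> S \<and> m \<in> I \<and> (\<forall>i\<in>I. m \<le> i) \<and> D \<inter> {m..} \<subseteq> I \<longrightarrow> P m I (v D)"
          using g[OF D] by (simp add: good_def)
      qed
      then obtain \<mu> where \<mu>: "\<And>D. D \<in> \<D> \<Longrightarrow> \<mu> D \<in> D"
        and P: "\<And>D I. D \<in> \<D> \<Longrightarrow> I \<subseteq> S \<Longrightarrow> \<mu> D \<in> I \<Longrightarrow> (\<forall>i\<in>I. \<mu> D \<le> i) \<Longrightarrow> D \<inter> {\<mu> D..} \<subseteq> I \<Longrightarrow> P (\<mu> D) I (v D)"
        by metis
      have sepD: "set_less D D' \<or> set_less D' D" if "D \<in> \<D>" "D' \<in> \<D>" "D \<noteq> D'" for D D'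
        using sep that by (simp add: separated_def)
      have less: "set_less D D'" if "D \<in> \<D>" "D' \<in> \<D>" "\<mu> D < \<mu> D'" for D D'
      proof -
        have "\<not> set_less D' D" using \<mu>[OF that(1)] \<mu>[OF that(2)] that(3) unfolding set_less_def by force
        moreover have "D \<noteq> D'" using that(3) by auto
        ultimately show ?thesis using sepD[OF that(1,2)] by simp
      qed
      have inj: "D = D'" if "D \<in> \<D>" "D' \<in> \<D>" "\<mu> D = \<mu> D'" for D D'
        using sepD[OF that(1,2)] \<mu>[OF that(1)] \<mu>[OF that(2)] that(3) unfolding set_less_def by fastforce
      obtain D0 where D0: "D0 \<in> \<D>" "\<And>D. D \<in> \<D> \<Longrightarrow> \<mu> D0 \<le> \<mu> D"
        using ex_min_if_finite[of "\<mu> ` \<D>"] fD nD by (auto simp: not_less)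
      define m where "m = \<mu> D0"
      have mE: "m \<in> \<Union>\<D>" using D0 \<mu> by (auto simp: m_def)
      have m1: "1 \<le> m" using mE sub ES S by auto
      show "\<exists>m\<in>E. \<forall>I. I \<subseteq> S \<and> m \<in> I \<and> (\<forall>i\<in>I. m \<le> i) \<and> E \<inter> {m..} \<subseteq> I \<longrightarrow> P m I (\<theta> * (\<Sum>D\<in>\<D>. v D))"
      proof (intro bexI[of _ m] allI impI)
        show "m \<in> E" using mE sub by blast
        fix I assume "I \<subseteq> S \<and> m \<in> I \<and> (\<forall>i\<in>I. m \<le> i) \<and> E \<inter> {m..} \<subseteq> I"
        then have IS: "I \<subseteq> S" and mI: "m \<in> I" and minI: "\<And>i. i \<in> I \<Longrightarrow> m \<le> i" and EI: "E \<inter> {m..} \<subseteq> I" by auto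
        \<comment> \<open>The chosen points of the children cut I into consecutive intervals, each
          reaching up to the next chosen point. Together they fill I, so nothing has to be
          discarded.\<close>
        define J where "J D = {i\<in>I. \<mu> D \<le> i \<and> (\<forall>D'\<in>\<D>. \<mu> D < \<mu> D' \<longrightarrow> i < \<mu> D')}" for D
        have \<mu>J: "\<mu> D \<in> J D" if D: "D \<in> \<D>" for D
        proof -
          have "\<mu> D \<in> E" "m \<le> \<mu> D" using \<mu> D D0 sub by (auto simp: m_def)
          then show ?thesis using EI by (auto simp: J_def)
        qed
        have JS: "J D \<subseteq> S" for D using IS by (auto simp: J_def)
        have PJ: "P (\<mu> D) (J D) (v D)" if D: "D \<in> \<D>" for D
        proof (rule P[OF D JS \<mu>J[OF D]])
          show "\<forall>i\<in>J D. \<mu> D \<le> i" by (auto simp: J_def)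
          show "D \<inter> {\<mu> D..} \<subseteq> J D"
          proof
            fix i assume i: "i \<in> D \<inter> {\<mu> D..}"
            then have "m \<le> i" using D0(2)[OF D] by (auto simp: m_def)
            then have "i \<in> I" using i D sub EI by auto
            moreover have "i < \<mu> D'" if "D' \<in> \<D>" "\<mu> D < \<mu> D'" for D'
              using less[OF D that] i \<mu>[OF that(1)] by (auto simp: set_less_def)
            ultimately show "i \<in> J D" using i by (auto simp: J_def)
          qed
        qed
        have Jless: "set_less (J D) (J D')" if "D \<in> \<D>" "D' \<in> \<D>" "\<mu> D < \<mu> D'" for D D'
          using that unfolding set_less_def J_def by fastforce
        have Jsep: "set_less (J D) (J D') \<or> set_less (J D') (J D)" if "D \<in> \<D>" "D' \<in> \<D>" "D \<noteq> D'" for D D'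
          using Jless[of D D'] Jless[of D' D] inj[of D D'] that by (meson linorder_neqE_nat)
        have injJ: "inj_on J \<D>"
          using Jsep \<mu>J unfolding inj_on_def set_less_def by (metis less_irrefl)
        have union: "\<Union>(J ` \<D>) = I"
        proof
          show "\<Union>(J ` \<D>) \<subseteq> I" by (auto simp: J_def)
          show "I \<subseteq> \<Union>(J ` \<D>)"
          proof
            fix i assume i: "i \<in> I"
            let ?Q = "{D\<in>\<D>. \<mu> D \<le> i}"
            have "finite (\<mu> ` ?Q)" "\<mu> ` ?Q \<noteq> {}" using fD D0(1) minI[OF i] by (auto simp: m_def)
            then have "Max (\<mu> ` ?Q) \<in> \<mu> ` ?Q" by (rule Max_in)
            then obtain D where D: "D \<in> \<D>" "\<mu> D \<le> i" "\<mu> D = Max (\<mu> ` ?Q)" by auto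
            have "i < \<mu> D'" if "D' \<in> \<D>" "\<mu> D < \<mu> D'" for D'
            proof (rule ccontr)
              assume "\<not> i < \<mu> D'"
              then have "\<mu> D' \<le> Max (\<mu> ` ?Q)" using that fD by (intro Max_ge) auto
              then show False using that D by simp
            qed
            then have "i \<in> J D" using D(1,2) i unfolding J_def by blast
            then show "i \<in> \<Union>(J ` \<D>)" using D(1) by blast
          qed
        qed
        have cardJ: "card (J ` \<D>) \<le> m" using card[OF mE] card_image_le[OF fD, of J] by linarith
        have sepJ: "separated (J ` \<D>)" using Jsep unfolding separated_def by blast
        have clow: "c m \<le> c (Suc m)" using c(1) by (simp add: incseq_SucD)
        \<comment> \<open>Every child other than the first has its chosen point at
          \<open>Suc m\<close> or later, and c is increasing.\<close>
        have Jge: "c (Suc m) * v D \<le> f (J D)" if D: "D \<in> \<D>" "D \<noteq> D0" for D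
        proof -
          have "m < \<mu> D" using D0(2)[OF D(1)] inj[OF D(1) D0(1)] D by (auto simp: m_def order_le_less)
          then have "c (Suc m) \<le> c (\<mu> D)" using c(1) by (auto simp: incseq_def)
          then have "c (Suc m) * v D \<le> c (\<mu> D) * v D" using g[OF D(1)] by (intro mult_right_mono) auto
          then show ?thesis using PJ[OF D(1)] by (auto simp: P_def)
        qed
        have vpos: "0 \<le> (\<Sum>D\<in>\<D>. v D)" using g by (intro sum_nonneg) auto
        have split: "(\<Sum>D\<in>\<D>. h D) = h D0 + (\<Sum>D\<in>\<D>-{D0}. h D)" for h :: "nat set \<Rightarrow> real"
          by (rule sum.remove[OF fD D0(1)])
        \<comment> \<open>The bound for the uncombined pieces: the node's own factor \<theta>
          offsets the constant \<open>c m\<close> of the first child.\<close>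
        have part: "c (Suc m) * (\<theta> * (\<Sum>D\<in>\<D>. v D)) \<le> (\<Sum>E\<in>J ` \<D>. f E)"
        proof -
          have "c (Suc m) * (\<theta> * (\<Sum>D\<in>\<D>. v D)) \<le> c m * (\<Sum>D\<in>\<D>. v D)"
            using mult_right_mono[OF c(3) vpos, of m] by (simp add: mult_ac)
          also have "\<dots> = (\<Sum>D\<in>\<D>. c m * v D)" by (simp add: sum_distrib_left)
          also have "\<dots> \<le> (\<Sum>D\<in>\<D>. f (J D))"
          proof (rule sum_mono)
            fix D assume D: "D \<in> \<D>"
            show "c m * v D \<le> f (J D)"
            proof (cases "D = D0")
              case True
              then show ?thesis using PJ[OF D] by (simp add: P_def m_def)
            next
              case False
              then show ?thesis using Jge[OF D] mult_right_mono[OF clow, of "v D"] g[OF D] by linarith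
            qed
          qed
          also have "\<dots> = (\<Sum>E\<in>J ` \<D>. f E)" by (simp add: sum.reindex[OF injJ])
          finally show ?thesis .
        qed
        text \<open>Splitting the first child into its own pieces replaces two nested lower estimates at
          the same \<open>m\<close> by a single one, so that the constant decreases only when \<open>m\<close> increases.\<close>
        obtain \<F> where F: "finite \<F>" "separated \<F>" "\<Union>\<F> = J D0" "card \<F> \<le> m"
            "c (Suc m) * v D0 \<le> (\<Sum>E\<in>\<F>. f E)"
          using PJ[OF D0(1)] unfolding P_def m_def by blast
        define \<G> where "\<G> = J ` (\<D> - {D0})"
        have disj: "set_less A B" if "A \<in> \<F>" "B \<in> \<G>" for A B
        proof -
          obtain D where D: "D \<in> \<D>" "D \<noteq> D0" "B = J D" using \<open>B \<in> \<G>\<close> by (auto simp: \<G>_def)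
          then have "\<mu> D0 < \<mu> D" using D0 inj by (metis order_le_less)
          then have "set_less (J D0) B" using Jless D D0 by auto
          then show ?thesis using F(3) \<open>A \<in> \<F>\<close> by (auto simp: set_less_def)
        qed
        have Gne: "B \<noteq> {}" if "B \<in> \<G>" for B using that \<mu>J by (auto simp: \<G>_def)
        have FG: "\<F> \<inter> \<G> = {}" using disj Gne by (fastforce simp: set_less_def)
        have "c m * \<theta> * (\<Sum>E\<in>\<F> \<union> \<G>. f E) \<le> c (Suc m) * f (\<Union>(\<F> \<union> \<G>))"
        proof (rule f_node)
          show "finite (\<F> \<union> \<G>)" using F fD by (simp add: \<G>_def)
          show "separated (\<F> \<union> \<G>)"
            by (rule separated_Un[OF F(2) separated_mono[OF sepJ] disj]) (auto simp: \<G>_def)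
          have "\<Union>(\<F> \<union> \<G>) \<subseteq> I" using F(3) union D0 by (auto simp: \<G>_def J_def)
          then show "\<Union>(\<F> \<union> \<G>) \<subseteq> S \<inter> {m..}" using IS minI by auto
          have "card \<G> \<le> m"
            using card_image_le[of "\<D> - {D0}" J] fD card_mono[OF fD, of "\<D> - {D0}"] card[OF mE]
            by (auto simp: \<G>_def)
          then show "card (\<F> \<union> \<G>) \<le> 2 * m" using F(4) card_Un_le[of \<F> \<G>] by linarith
        qed (rule m1)
        moreover have "\<Union>(\<F> \<union> \<G>) = I"
          using union F(3) D0(1) unfolding \<G>_def by blast
        moreover have "c (Suc m) * (\<Sum>D\<in>\<D>. v D) \<le> (\<Sum>E\<in>\<F> \<union> \<G>. f E)"
        proof -
          have inj2: "inj_on J (\<D> - {D0})" by (rule inj_on_subset[OF injJ]) auto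
          have "c (Suc m) * (\<Sum>D\<in>\<D>. v D) = c (Suc m) * v D0 + (\<Sum>D\<in>\<D>-{D0}. c (Suc m) * v D)"
            by (simp add: split[of v] sum_distrib_left ring_distribs)
          also have "\<dots> \<le> (\<Sum>E\<in>\<F>. f E) + (\<Sum>D\<in>\<D>-{D0}. f (J D))"
            using F(5) Jge by (intro add_mono sum_mono) auto
          also have "\<dots> = (\<Sum>E\<in>\<F> \<union> \<G>. f E)"
            using F(1) fD FG by (subst sum.union_disjoint) (auto simp: \<G>_def sum.reindex[OF inj2])
          finally show ?thesis .
        qed
        moreover from this have
          "(c m * \<theta>) * (c (Suc m) * (\<Sum>D\<in>\<D>. v D)) \<le> (c m * \<theta>) * (\<Sum>E\<in>\<F> \<union> \<G>. f E)"
          by (rule mult_left_mono) (use c(2)[of m] \<theta> in simp)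
        \<comment> \<open>All pieces, absorbed or not, carry the constant \<open>c (Suc m)\<close>.
          It cancels against the one in \<open>f_node\<close>, and a single factor
          \<open>c m\<close> remains.\<close>
        ultimately have "(c m * \<theta>) * (c (Suc m) * (\<Sum>D\<in>\<D>. v D)) \<le> c (Suc m) * f I"
          by (metis order_trans)
        then have le: "c (Suc m) * (c m * (\<theta> * (\<Sum>D\<in>\<D>. v D))) \<le> c (Suc m) * f I"
          by (simp add: mult_ac)
        have "0 \<le> f I" using f_leaf[OF IS mI minI, of 0] c(2)[of 0] by (meson abs_ge_zero mult_nonneg_nonneg order_trans)
        have "c m * (\<theta> * (\<Sum>D\<in>\<D>. v D)) \<le> f I"
        proof (cases "c (Suc m) = 0")
          case True
          then show ?thesis using \<open>0 \<le> f I\<close> clow c(2)[of m] by simp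
        next
          case False
          then have "0 < c (Suc m)" using c(2)[of "Suc m"] by simp
          then show ?thesis using le by simp
        qed
        then show "P m I (\<theta> * (\<Sum>D\<in>\<D>. v D))"
          unfolding P_def using fD sepJ union cardJ part by blast
      qed
    qed
  next
    have "restr S a = a" using S(4) by (force simp: restr_def fun_eq_iff)
    then show "s < N (restr S a)" using s by simp
  qed (use S in auto)
  then obtain m where m: "m \<in> S" and "\<And>I. I \<subseteq> S \<and> m \<in> I \<and> (\<forall>i\<in>I. m \<le> i) \<and> S \<inter> {m..} \<subseteq> I \<Longrightarrow> P m I s"
    unfolding good_def by blast
  then have "P m (S \<inter> {m..}) s" by auto
  then show ?thesis using m unfolding P_def by blast
qed

section \<open>Almost monotone extension by compactness and Ramsey's theorem\<close>

text \<open>Induction on the generators: a new vector b has positive distance from the old span,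
  which bounds its coefficient on the unit ball. The ball is thus covered by a sum of two compact
  sets.\<close>

lemma finite_span_unit_ball_compact:
  fixes S :: "'a::real_normed_vector set"
  assumes "finite S"
  shows "\<exists>C. compact C \<and> C \<subseteq> span S \<and> (\<forall>v\<in>span S. norm v \<le> 1 \<longrightarrow> v \<in> C)"
  using assms
proof (induction S)
  case empty
  show ?case by (rule exI[of _ "{0}"]) auto
next
  case (insert b S)
  then obtain C where C: "compact C" "C \<subseteq> span S" "\<And>v. v \<in> span S \<Longrightarrow> norm v \<le> 1 \<Longrightarrow> v \<in> C" by blast
  show ?case
  proof (cases "b \<in> span S")
    case True
    show ?thesis unfolding span_redundant[OF True] using C by blast
  next
    case False
    have inC: "v \<in> (*\<^sub>R) R ` C" if "v \<in> span S" "norm v \<le> R" "0 < R" for v R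
    proof
      show "v = R *\<^sub>R (v /\<^sub>R R)" using that by simp
      show "v /\<^sub>R R \<in> C" using that by (intro C(3) span_scale) (auto simp: field_simps)
    qed
    \<comment> \<open>A convergent sequence is bounded, so it stays in one multiple of C, and
      compact sets are closed.\<close>
    have cl: "closed (span S)"
    proof (rule closed_sequential_limits[THEN iffD2, rule_format])
      fix x v assume "(\<forall>n. x n \<in> span S) \<and> x \<longlonglongrightarrow> v"
      then have x: "\<And>n. x n \<in> span S" and lim: "x \<longlonglongrightarrow> v" by auto
      obtain R where R: "0 < R" "\<And>n. norm (x n) \<le> R"
        using convergent_imp_Bseq[of x] lim unfolding Bseq_def convergent_def by blast
      have "\<And>n. x n \<in> (*\<^sub>R) R ` C" by (rule inC[OF x R(2) R(1)])
      then have "v \<in> (*\<^sub>R) R ` C"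
        by (rule closed_sequentially[OF compact_imp_closed[OF compact_scaling[OF C(1)]] _ lim])
      then obtain c where "c \<in> C" "v = R *\<^sub>R c" by blast
      then show "v \<in> span S" using C(2) span_scale[of c S R] by (simp add: subset_iff)
    qed
    define d where "d = infdist b (span S)"
    have ne: "span S \<noteq> {}" using span_zero by blast
    have d: "0 < d" unfolding d_def using infdist_pos_not_in_closed[OF cl ne False] .
    \<comment> \<open>With the coefficient t of b at most 1 / d in absolute value, the remainder of
      a unit vector has norm at most R.\<close>
    define R where "R = 1 + norm b / d"
    have R: "0 < R" using d by (simp add: R_def add_pos_nonneg)
    define C' where "C' = {x + y | x y. x \<in> (*\<^sub>R) R ` C \<and> y \<in> (\<lambda>t. t *\<^sub>R b) ` {-1/d..1/d}}"
    have "compact C'"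
      unfolding C'_def
      by (intro compact_sums compact_scaling C(1) compact_continuous_image compact_Icc)
         (intro continuous_intros)
    moreover have "C' \<subseteq> span (insert b S)"
    proof -
      have "C \<subseteq> span (insert b S)" using C(2) span_mono[of S "insert b S"] by blast
      then show ?thesis unfolding C'_def
        by (clarsimp simp: subset_iff) (intro span_add span_scale, auto intro: span_base)
    qed
    moreover have "v \<in> C'" if v: "v \<in> span (insert b S)" "norm v \<le> 1" for v
    proof -
      obtain t where t: "v - t *\<^sub>R b \<in> span S" using v(1) span_breakdown_eq by blast
      have "\<bar>t\<bar> * d \<le> 1"
      proof (cases "t = 0")
        case False
        have "d \<le> dist b (- (1/t) *\<^sub>R (v - t *\<^sub>R b))"
          unfolding d_def by (intro infdist_le span_scale t)
        also have "\<dots> = norm ((1/t) *\<^sub>R v)" using False by (simp add: dist_norm scaleR_diff_right)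
        also have "\<dots> \<le> 1 / \<bar>t\<bar>" using v(2) by (simp add: divide_right_mono)
        finally show ?thesis using False by (simp add: field_simps)
      qed simp
      then have t': "\<bar>t\<bar> \<le> 1 / d" using d by (simp add: field_simps)
      have "norm (v - t *\<^sub>R b) \<le> norm v + \<bar>t\<bar> * norm b"
        by (rule order_trans[OF norm_triangle_ineq4]) simp
      also have "\<dots> \<le> R" using v(2) mult_right_mono[OF t', of "norm b"] by (simp add: R_def)
      finally have "v - t *\<^sub>R b \<in> (*\<^sub>R) R ` C" by (intro inC t R)
      moreover have "t *\<^sub>R b \<in> (\<lambda>t. t *\<^sub>R b) ` {-1/d..1/d}" using t' by (intro imageI) (auto simp: abs_le_iff)
      ultimately show ?thesis unfolding C'_def by (intro CollectI exI[of _ "v - t *\<^sub>R b"] exI[of _ "t *\<^sub>R b"]) auto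
    qed
    ultimately show ?thesis by blast
  qed
qed

text \<open>Telescoping over a monochromatic set: the average of \<open>h + t (w\<^bsub>i\<^sub>r\<^esub> - w\<^bsub>i\<^sub>r\<^sub>+\<^sub>1\<^esub>)\<close> over \<open>r < n\<close> tends to \<open>h\<close>,
  so the norm cannot drop for every pair.\<close>

lemma ramsey_difference:
  fixes w :: "nat \<Rightarrow> 'a::real_normed_vector"
  assumes K: "compact K" and B: "\<And>i. norm (w i) \<le> B" and \<eta>: "0 < \<eta>"
  shows "\<exists>i j. i < j \<and> (\<forall>h\<in>K. \<forall>t\<in>{-T..T}. norm h - \<eta> \<le> norm (h + t *\<^sub>R (w i - w j)))"
proof (rule ccontr)
  assume "\<not> ?thesis"
  then have bad: "\<exists>h\<in>K. \<exists>t\<in>{-T..T}. norm (h + t *\<^sub>R (w i - w j)) < norm h - \<eta>" if "i < j" for i j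
    using that by (auto simp: not_le)
  have B0: "0 \<le> B" using B[of 0] norm_ge_zero order_trans by blast
  have dw: "norm (w i - w j) \<le> 2 * B" for i j
    using norm_triangle_ineq4[of "w i" "w j"] B[of i] B[of j] by linarith
  \<comment> \<open>Passing from (h, t) to a point of an r-net costs r for each of the two
    occurrences of h and \<open>2 * B * r\<close> for t: half of \<eta> altogether.\<close>
  define r where "r = \<eta> / (4 * (1 + B))"
  have r: "0 < r" and r2: "r * (2 + 2 * B) = \<eta> / 2" using \<eta> B0 by (auto simp: r_def field_simps)
  have "compact (K \<times> {-T..T})" by (intro compact_Times K compact_Icc)
  then obtain A where A: "finite A" "A \<subseteq> K \<times> {-T..T}" "K \<times> {-T..T} \<subseteq> (\<Union>p\<in>A. ball p r)"
    by (rule compactE_image[where f = "\<lambda>p. ball p r" and C = "K \<times> {-T..T}"]) (use r in auto)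
  obtain s :: nat and g where g: "A = g ` {p. p < s}"
    using finite_imp_nat_seg_image_inj_on[OF A(1)] by blast
  define Bad where "Bad p i j \<longleftrightarrow> (case p of (h, t) \<Rightarrow> norm (h + t *\<^sub>R (w i - w j)) < norm h - \<eta> / 2)" for p i j
  have ex: "\<exists>p<s. Bad (g p) i j" if "i < j" for i j
  proof -
    obtain h t where ht: "h \<in> K" "t \<in> {-T..T}" "norm (h + t *\<^sub>R (w i - w j)) < norm h - \<eta>"
      using bad[OF \<open>i < j\<close>] by blast
    have "(h, t) \<in> (\<Union>p\<in>A. ball p r)" using A(3) ht by blast
    then obtain p where p: "p < s" "dist (g p) (h, t) < r" unfolding g by (auto simp: mem_ball)
    obtain h' t' where g': "g p = (h', t')" by (cases "g p")
    have dh: "norm (h' - h) < r" and dt: "\<bar>t' - t\<bar> < r"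
      using p dist_fst_le[of "g p" "(h,t)"] dist_snd_le[of "g p" "(h,t)"]
      by (auto simp: g' dist_norm)
    have "norm ((t' - t) *\<^sub>R (w i - w j)) \<le> r * (2 * B)"
      unfolding norm_scaleR using dt dw r by (intro mult_mono) auto
    moreover have "h' + t' *\<^sub>R (w i - w j) = (h + t *\<^sub>R (w i - w j)) + (h' - h) + (t' - t) *\<^sub>R (w i - w j)"
      by (simp add: algebra_simps)
    then have "norm (h' + t' *\<^sub>R (w i - w j)) \<le> norm (h + t *\<^sub>R (w i - w j)) + norm (h' - h) + norm ((t' - t) *\<^sub>R (w i - w j))"
      by (metis norm_triangle_ineq norm_triangle_mono order_refl)
    moreover have "norm h - norm h' \<le> r" using norm_triangle_ineq2[of h h'] dh by (simp add: norm_minus_commute)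
    moreover have "r * (2 + 2 * B) = 2 * r + r * (2 * B)" by (simp add: algebra_simps)
    ultimately have "norm (h' + t' *\<^sub>R (w i - w j)) < norm h' - \<eta> / 2" using ht(3) dh r2 by linarith
    then show ?thesis using p(1) g' by (auto simp: Bad_def)
  qed
  \<comment> \<open>A pair is coloured by a net point at which the norm drops. On a monochromatic
    set one fixed (h, t) fails for all pairs.\<close>
  define col where "col X = (SOME p. p < s \<and> Bad (g p) (Min X) (Max X))" for X
  have col: "col {i, j} < s \<and> Bad (g (col {i, j})) i j" if "i < j" for i j
  proof -
    have "Min {i, j} = i" "Max {i, j} = j" using that by auto
    then show ?thesis unfolding col_def using someI_ex[OF ex[OF that]] by simp
  qed
  have "\<forall>x\<in>UNIV. \<forall>y\<in>UNIV. x \<noteq> y \<longrightarrow> col {x, y} < s"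
  proof (intro ballI impI)
    fix x y :: nat assume "x \<noteq> y"
    then show "col {x, y} < s"
      using col[of x y] col[of y x] by (cases x y rule: linorder_cases) (auto simp: insert_commute)
  qed
  then obtain Y p where Y: "infinite Y" "\<forall>x\<in>Y. \<forall>y\<in>Y. x \<noteq> y \<longrightarrow> col {x, y} = p" "p < s"
    using Ramsey2[OF infinite_UNIV_nat, of col s] by blast
  obtain h t where ht: "g p = (h, t)" by (cases "g p")
  define e where "e = enumerate Y"
  have e: "e r \<in> Y" "e r < e (Suc r)" for r
    using Y(1) by (auto simp: e_def enumerate_in_set enumerate_step)
  have le: "norm (h + t *\<^sub>R (w (e r) - w (e (Suc r)))) \<le> norm h - \<eta> / 2" for r
  proof -
    have "Bad (g p) (e r) (e (Suc r))" using col[OF e(2)] Y(2) e by (metis less_irrefl)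
    then show ?thesis by (simp add: Bad_def ht)
  qed
  \<comment> \<open>By telescoping the sum stays within a bounded distance of n h, while its norm
    would fall short of n times the norm of h by an amount growing linearly in n.\<close>
  have bound: "real n * (\<eta> / 2) \<le> \<bar>t\<bar> * (2 * B)" for n
  proof -
    have "(\<Sum>r<n. w (e r) - w (e (Suc r))) = w (e 0) - w (e n)"
      using sum_lessThan_telescope'[of "\<lambda>r. w (e r)" n] .
    then have "(\<Sum>r<n. h + t *\<^sub>R (w (e r) - w (e (Suc r)))) = real n *\<^sub>R h + t *\<^sub>R (w (e 0) - w (e n))"
      by (simp add: sum.distrib scaleR_sum_right[symmetric] sum_constant_scaleR del: sum_constant)
    then have "norm (real n *\<^sub>R h + t *\<^sub>R (w (e 0) - w (e n))) \<le> (\<Sum>r<n. norm h - \<eta> / 2)"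
      using sum_norm_le[of "{..<n}" "\<lambda>r. h + t *\<^sub>R (w (e r) - w (e (Suc r)))" "\<lambda>_. norm h - \<eta> / 2"] le
      by simp
    moreover have "norm (real n *\<^sub>R h) \<le> norm (real n *\<^sub>R h + t *\<^sub>R (w (e 0) - w (e n))) + norm (t *\<^sub>R (w (e 0) - w (e n)))"
      using norm_triangle_ineq4[of "real n *\<^sub>R h + t *\<^sub>R (w (e 0) - w (e n))" "t *\<^sub>R (w (e 0) - w (e n))"] by simp
    moreover have "norm (t *\<^sub>R (w (e 0) - w (e n))) \<le> \<bar>t\<bar> * (2 * B)"
      unfolding norm_scaleR by (intro mult_left_mono dw) simp
    ultimately show ?thesis by (simp add: algebra_simps)
  qed
  obtain n where "real n > \<bar>t\<bar> * (2 * B) / (\<eta> / 2)" using reals_Archimedean2 by blast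
  then have "\<bar>t\<bar> * (2 * B) < real n * (\<eta> / 2)" using \<eta> by (simp add: field_simps)
  then show False using bound[of n] by simp
qed

text \<open>In Mazur's construction the next vector is usually taken in the kernel of functionals norming
  \<open>span F\<close>; here a normalized difference of two terms serves instead.\<close>

lemma mazur_step:
  fixes w :: "nat \<Rightarrow> 'a::real_normed_vector"
  assumes F: "finite F" and w: "\<And>i. norm (w i) = 1" and \<kappa>: "0 < \<kappa>" "\<And>i j. i < j \<Longrightarrow> \<kappa> \<le> norm (w i - w j)"
    and \<eta>: "0 < \<eta>"
  shows "\<exists>r\<in>span (range w). norm r = 1 \<and> (\<forall>h\<in>span F. \<forall>t. (1 - \<eta>) * norm h \<le> norm (h + t *\<^sub>R r))"
proof -
  obtain C where C: "compact C" "\<And>v. v \<in> span F \<Longrightarrow> norm v \<le> 1 \<Longrightarrow> v \<in> C"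
    using finite_span_unit_ball_compact[OF F] by blast
  obtain i j where ij: "i < j"
    and low: "\<And>h t. h \<in> C \<Longrightarrow> t \<in> {-2/\<kappa>..2/\<kappa>} \<Longrightarrow> norm h - \<eta> \<le> norm (h + t *\<^sub>R (w i - w j))"
    using ramsey_difference[OF C(1), of w 1 \<eta> "2/\<kappa>"] w \<eta> by auto
  define N where "N = norm (w i - w j)"
  have N: "\<kappa> \<le> N" "0 < N" using \<kappa>(1) \<kappa>(2)[OF ij] unfolding N_def by linarith+
  define r where "r = (w i - w j) /\<^sub>R N"
  have r1: "norm r = 1" using N by (simp add: r_def N_def)
  have "(1 - \<eta>) * norm h \<le> norm (h + t *\<^sub>R r)" if h: "h \<in> span F" for h t
  proof (cases "h = 0")
    case False
    define h' where "h' = h /\<^sub>R norm h"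
    define t' where "t' = t / norm h"
    have h': "norm h' = 1" "h' \<in> C" using False h by (auto simp: h'_def intro!: C(2) span_scale)
    have "1 - \<eta> \<le> norm (h' + t' *\<^sub>R r)"
    \<comment> \<open>Only bounded t need compactness: for larger t the triangle inequality already
      gives a norm above 1. Division by \<open>N \<ge> \<kappa>\<close> explains the range up to
      \<open>2 / \<kappa>\<close>.\<close>
    proof (cases "\<bar>t'\<bar> \<le> 2")
      case True
      have "\<bar>t' / N\<bar> \<le> 2 / \<kappa>" unfolding abs_divide using True N \<kappa>(1) by (intro frac_le) auto
      then have "t' / N \<le> 2 / \<kappa>" "- (t' / N) \<le> 2 / \<kappa>" by (simp_all only: abs_le_iff)
      then have "norm h' - \<eta> \<le> norm (h' + (t' / N) *\<^sub>R (w i - w j))"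
        by (intro low h') simp
      then show ?thesis using h' by (simp add: r_def divide_inverse)
    next
      case False
      have "\<bar>t'\<bar> = norm (t' *\<^sub>R r)" using r1 by simp
      also have "\<dots> \<le> norm (h' + t' *\<^sub>R r) + norm h'" by (metis add_diff_cancel_left' norm_triangle_ineq4)
      finally show ?thesis using False h' \<eta> by linarith
    qed
    moreover have "h + t *\<^sub>R r = norm h *\<^sub>R (h' + t' *\<^sub>R r)" using False by (simp add: h'_def t'_def algebra_simps)
    then have "norm (h + t *\<^sub>R r) = norm h * norm (h' + t' *\<^sub>R r)" by simp
    ultimately show ?thesis by (simp add: mult.commute mult_left_mono)
  qed simp
  moreover have "r \<in> span (range w)"
    unfolding r_def by (intro span_scale span_diff span_base) auto
  ultimately show ?thesis using r1 by blast
qed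

section \<open>Unique expansions and supports\<close>

text \<open>Uniqueness on the algebraic span is all that supports of finite blocks depend on. Unlike
  \<open>basic_seq\<close> it passes easily to tails, and for the constructed sequence it follows
  directly from almost monotonicity.\<close>

definition unique_expansions :: "(nat \<Rightarrow> 'a::banach) \<Rightarrow> bool" where
  "unique_expansions w \<longleftrightarrow>
     (\<forall>v\<in>span (w ` {1..}). \<forall>a b. expansion w a v \<longrightarrow> expansion w b v \<longrightarrow> a = b)"

lemma basic_seq_unique_expansions: "basic_seq w \<Longrightarrow> unique_expansions w"
  unfolding basic_seq_def unique_expansions_def using closure_subset by blast

lemma span_expansion:
  assumes "v \<in> span (w ` Q)" "Q \<subseteq> {1..}"
  shows "\<exists>a. finite {i. a i \<noteq> 0} \<and> {i. a i \<noteq> 0} \<subseteq> Q \<and> expansion w a v"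
  using assms(1)
proof (induction v rule: span_induct_alt)
  case base
  show ?case by (rule exI[of _ "\<lambda>_. 0"]) (simp add: expansion_def)
next
  case (step c x y)
  then obtain j a where j: "j \<in> Q" "x = w j"
    and a: "finite {i. a i \<noteq> 0}" "{i. a i \<noteq> 0} \<subseteq> Q" "expansion w a y" by blast
  define b where "b i = a i + (if i = j then c else 0)" for i
  have sub: "{i. b i \<noteq> 0} \<subseteq> insert j {i. a i \<noteq> 0}" by (auto simp: b_def)
  have "(\<lambda>i. if i = j then c *\<^sub>R w i else 0) sums (c *\<^sub>R w j)"
    using sums_single[of j "\<lambda>i. c *\<^sub>R w i"] by simp
  then have "(\<lambda>i. a i *\<^sub>R w i + (if i = j then c *\<^sub>R w i else 0)) sums (y + c *\<^sub>R w j)"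
    using a(3) by (intro sums_add) (auto simp: expansion_def)
  moreover have "b i *\<^sub>R w i = a i *\<^sub>R w i + (if i = j then c *\<^sub>R w i else 0)" for i
    by (simp add: b_def scaleR_add_left)
  moreover have "b 0 = 0" using a(3) j(1) assms(2) by (auto simp: b_def expansion_def)
  ultimately have "expansion w b (c *\<^sub>R x + y)" by (simp add: expansion_def j(2) add.commute)
  moreover have "finite {i. b i \<noteq> 0}" "{i. b i \<noteq> 0} \<subseteq> Q"
    using finite_subset[OF sub] sub a j by auto
  ultimately show ?case by blast
qed

lemma supp_span:
  assumes w: "unique_expansions w" and v: "v \<in> span (w ` Q)" and Q: "Q \<subseteq> {1..}"
  shows "finite (supp w v)" "supp w v \<subseteq> Q" "v \<in> span (w ` supp w v)" "v \<noteq> 0 \<Longrightarrow> supp w v \<noteq> {}"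
proof -
  obtain a where a: "finite {i. a i \<noteq> 0}" "{i. a i \<noteq> 0} \<subseteq> Q" "expansion w a v"
    using span_expansion[OF v Q] by blast
  have "v \<in> span (w ` {1..})" using v span_mono[of "w ` Q" "w ` {1..}"] Q by blast
  then have "(THE a. expansion w a v) = a"
    using w a(3) unfolding unique_expansions_def by (intro the_equality) blast+
  then have s: "supp w v = {i. a i \<noteq> 0}" by (simp add: supp_def)
  have "(\<lambda>i. a i *\<^sub>R w i) sums (\<Sum>i | a i \<noteq> 0. a i *\<^sub>R w i)"
    by (rule sums_finite[OF a(1)]) auto
  then have v_eq: "v = (\<Sum>i | a i \<noteq> 0. a i *\<^sub>R w i)"
    using a(3) sums_unique2 unfolding expansion_def by blast
  show "finite (supp w v)" "supp w v \<subseteq> Q" using a s by auto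
  show "v \<in> span (w ` supp w v)"
    unfolding s by (subst v_eq) (intro span_sum span_scale span_base, auto)
  show "supp w v \<noteq> {}" if "v \<noteq> 0" using v_eq that s by (metis sum.empty)
qed

lemma expansion_unit:
  assumes "1 \<le> j"
  shows "expansion w (unit_vec j) (w j)"
proof -
  have "(\<lambda>i. unit_vec j i *\<^sub>R w i) sums w j"
    using sums_single[of j w] by (rule sums_cong[THEN iffD1, rotated]) (simp add: unit_vec_def)
  then show ?thesis using assms by (simp add: expansion_def unit_vec_def)
qed

lemma supp_self:
  assumes w: "unique_expansions w" and j: "1 \<le> j"
  shows "supp w (w j) = {j}"
proof -
  have "w j \<in> span (w ` {1..})" using j by (intro span_base) auto
  then have "(THE a. expansion w a (w j)) = unit_vec j"
    using w expansion_unit[OF j] unfolding unique_expansions_def by (intro the_equality) blast+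
  then show ?thesis by (simp add: supp_def unit_vec_def)
qed

lemma unique_expansions_nonzero:
  assumes w: "unique_expansions w" and j: "1 \<le> j"
  shows "w j \<noteq> 0"
proof
  assume "w j = 0"
  then have "expansion w (unit_vec j) 0" using expansion_unit[OF j, of w] by simp
  moreover have "expansion w (\<lambda>_. 0) 0" by (simp add: expansion_def)
  ultimately have "unit_vec j = (\<lambda>_. 0)" using w span_zero unfolding unique_expansions_def by blast
  then show False by (metis unit_vec_def zero_neq_one)
qed

lemma unique_expansions_tail:
  assumes w: "unique_expansions w" and n: "1 \<le> n"
  shows "unique_expansions (\<lambda>i. w (i + n - 1))"
  unfolding unique_expansions_def
proof (intro ballI allI impI)
  let ?t = "\<lambda>i. w (i + n - 1)"
  define k where "k = n - 1"
  have t: "i + n - 1 = i + k" for i using n by (simp add: k_def)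
  \<comment> \<open>Coefficients of the tail become coefficients of w by a shift, with zeros in
    front, so uniqueness for w transfers.\<close>
  define sh where "sh a i = (if i \<le> k then 0 else a (i - k))" for a :: "nat \<Rightarrow> real" and i
  have ex: "expansion w (sh a) v" if "expansion ?t a v" for a v
  proof -
    have a: "a 0 = 0" "(\<lambda>i. a i *\<^sub>R w (i + k)) sums v" using that by (auto simp only: expansion_def t)
    have "(\<lambda>i. sh a (i + k) *\<^sub>R w (i + k)) sums v"
      using a by (auto simp: sh_def intro: sums_cong[THEN iffD1, rotated, OF a(2)])
    then have "(\<lambda>i. sh a i *\<^sub>R w i) sums (v + (\<Sum>i<k. sh a i *\<^sub>R w i))"
      by (subst sums_iff_shift'[symmetric, where n = k]) simp
    moreover have "(\<Sum>i<k. sh a i *\<^sub>R w i) = 0" by (rule sum.neutral) (auto simp: sh_def)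
    ultimately show ?thesis by (simp add: expansion_def sh_def)
  qed
  fix v a b assume v: "v \<in> span (?t ` {1..})" and a: "expansion ?t a v" and b: "expansion ?t b v"
  have "?t ` {1..} \<subseteq> w ` {1..}" using n by auto
  then have "v \<in> span (w ` {1..})" using v span_mono by blast
  then have eq: "sh a = sh b" using w ex[OF a] ex[OF b] unfolding unique_expansions_def by blast
  show "a = b"
  proof
    fix i
    show "a i = b i"
    proof (cases "i = 0")
      case True
      then show ?thesis using a b by (simp add: expansion_def)
    next
      case False
      then show ?thesis using fun_cong[OF eq, of "i + k"] by (simp add: sh_def)
    qed
  qed
qed

section \<open>Lower l_1 estimates from stabilization\<close>

text \<open>At most K vectors supported from K on satisfy the Schreier condition, so the estimate
  for 1-admissible sequences applies. The unordered form matches \<open>separated\<close> families,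
  and zero vectors are permitted.\<close>

lemma l1_lower_estimate_separated:
  fixes V :: "'j \<Rightarrow> 'a::banach"
  assumes w: "unique_expansions w"
    and d: "\<And>k y. admissible l 1 w k y \<Longrightarrow> d * (\<Sum>i=1..k. norm (y i)) \<le> norm (\<Sum>i=1..k. y i)"
    and J: "finite J" "card J \<le> K" and K: "1 \<le> K"
    and V: "\<And>j. j \<in> J \<Longrightarrow> V j \<in> span (w ` H j)"
    and H: "\<And>j. j \<in> J \<Longrightarrow> H j \<subseteq> {K..}"
    and sep: "\<And>i j. i \<in> J \<Longrightarrow> j \<in> J \<Longrightarrow> i \<noteq> j \<Longrightarrow> set_less (H i) (H j) \<or> set_less (H j) (H i)"
  shows "d * (\<Sum>j\<in>J. norm (V j)) \<le> norm (\<Sum>j\<in>J. V j)"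
proof -
  \<comment> \<open>Block sequences consist of nonzero vectors; zero vectors change neither side.
    The remaining ones are numbered by increasing minimum of their supports.\<close>
  define J' where "J' = {j\<in>J. V j \<noteq> 0}"
  define \<mu> where "\<mu> j = Min (supp w (V j))" for j
  have fJ': "finite J'" using J by (simp add: J'_def)
  have S: "finite (supp w (V j))" "supp w (V j) \<subseteq> H j" "supp w (V j) \<noteq> {}" if "j \<in> J'" for j
  proof -
    have j: "j \<in> J" "V j \<noteq> 0" using that by (auto simp: J'_def)
    have "H j \<subseteq> {1..}" using H[OF j(1)] K by auto
    then show "finite (supp w (V j))" "supp w (V j) \<subseteq> H j" "supp w (V j) \<noteq> {}"
      using supp_span[OF w V[OF j(1)]] j(2) by auto
  qed
  have \<mu>: "\<mu> j \<in> supp w (V j)" if "j \<in> J'" for j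
    unfolding \<mu>_def using S[OF that] by (intro Min_in)
  have less: "Max (supp w (V i)) < \<mu> j" if ij: "i \<in> J'" "j \<in> J'" "\<mu> i < \<mu> j" for i j
  proof -
    have "set_less (H i) (H j) \<or> set_less (H j) (H i)"
      using sep[of i j] ij by (auto simp: J'_def)
    moreover have "\<mu> i \<in> H i" "\<mu> j \<in> H j" using \<mu> S ij by blast+
    ultimately have "set_less (H i) (H j)" using ij(3) unfolding set_less_def by (meson less_asym)
    moreover have "Max (supp w (V i)) \<in> H i" using Max_in S[OF ij(1)] by blast
    ultimately show ?thesis using \<open>\<mu> j \<in> H j\<close> by (auto simp: set_less_def)
  qed
  have inj: "inj_on \<mu> J'"
  proof (rule inj_onI, rule ccontr)
    fix i j assume ij: "i \<in> J'" "j \<in> J'" "\<mu> i = \<mu> j" "i \<noteq> j"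
    then have "set_less (H i) (H j) \<or> set_less (H j) (H i)" using sep[of i j] by (auto simp: J'_def)
    moreover have "\<mu> i \<in> H i" "\<mu> i \<in> H j" using \<mu>[of i] \<mu>[of j] S ij by force+
    ultimately show False by (auto simp: set_less_def)
  qed
  define k where "k = card J'"
  define L where "L = sorted_list_of_set (\<mu> ` J')"
  have L: "set L = \<mu> ` J'" "sorted_wrt (<) L" "length L = k"
    using fJ' by (auto simp: L_def k_def card_image[OF inj])
  define e where "e i = inv_into J' \<mu> (L ! (i - 1))" for i
  have e: "e i \<in> J'" "\<mu> (e i) = L ! (i - 1)" if "i \<in> {1..k}" for i
  proof -
    have "L ! (i - 1) \<in> \<mu> ` J'" using L that nth_mem[of "i - 1" L] by auto
    then show "e i \<in> J'" "\<mu> (e i) = L ! (i - 1)"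
      by (auto simp: e_def inv_into_into f_inv_into_f)
  qed
  have mono: "\<mu> (e i) < \<mu> (e j)" if "i \<in> {1..k}" "j \<in> {1..k}" "i < j" for i j
    using e that L by (auto intro!: sorted_wrt_nth_less[OF L(2)])
  have inje: "inj_on e {1..k}"
    using mono by (intro inj_onI) (metis less_irrefl linorder_neqE_nat)
  have bij: "e ` {1..k} = J'"
    using e inje fJ' by (intro card_subset_eq) (auto simp: card_image k_def)
  define y where "y i = V (e i)" for i
  have "admissible l 1 w k y"
    unfolding admissible_def
  proof
    have "y i \<in> span (w ` {1..})" if "i \<in> {1..k}" for i
    proof -
      have "e i \<in> J" using e that by (auto simp: J'_def)
      then have "y i \<in> span (w ` H (e i))" "H (e i) \<subseteq> {1..}" using V H K by (force simp: y_def)+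
      then show ?thesis using span_mono[of "w ` H (e i)" "w ` {1..}"] by blast
    qed
    moreover have "y i \<noteq> 0" if "i \<in> {1..k}" for i using e(1)[OF that] by (simp add: y_def J'_def)
    moreover have "Max (supp w (y i)) < Min (supp w (y j))" if "i \<in> {1..k}" "j \<in> {1..k}" "i < j" for i j
      using less[OF e(1)[OF that(1)] e(1)[OF that(2)] mono[OF that]] by (simp add: y_def \<mu>_def)
    ultimately show "block_on w {1..k} y" by (simp add: block_on_def)
    have img: "(\<lambda>i. Min (supp w (y i))) ` {1..k} = \<mu> ` J'"
      unfolding bij[symmetric] by (simp add: y_def \<mu>_def image_image)
    show "(\<lambda>i. Min (supp w (y i))) ` {1..k} \<in> schreier l 1"
      unfolding img schreier_1 schreier_one_def
    proof (cases "J' = {}")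
      case False
      have "card (\<mu> ` J') \<le> K"
        using card_image_le[OF fJ', of \<mu>] card_mono[OF J(1), of J'] J(2) by (auto simp: J'_def)
      also have "K \<le> Min (\<mu> ` J')"
      proof (rule Min.boundedI)
        fix q assume "q \<in> \<mu> ` J'"
        then obtain j where "j \<in> J'" "q = \<mu> j" by blast
        then have "q \<in> H j" "j \<in> J" using \<mu> S(2) by (auto simp: J'_def)
        then show "K \<le> q" using H by auto
      qed (use False fJ' in auto)
      finally show "\<mu> ` J' \<in> {F. finite F \<and> F \<noteq> {} \<and> card F \<le> Min F} \<union> {{}}"
        using False fJ' by auto
    qed auto
  qed
  from d[OF this] have "d * (\<Sum>j\<in>J'. norm (V j)) \<le> norm (\<Sum>j\<in>J'. V j)"
    unfolding y_def bij[symmetric] sum.reindex[OF inje] by (simp add: o_def)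
  moreover have "(\<Sum>j\<in>J'. norm (V j)) = (\<Sum>j\<in>J. norm (V j))" "(\<Sum>j\<in>J'. V j) = (\<Sum>j\<in>J. V j)"
    unfolding J'_def using J(1) by (auto intro!: sum.mono_neutral_left)
  ultimately show ?thesis by simp
qed

lemma Delta_stabilizes_tail:
  assumes st: "Delta_stabilizes l z \<gamma>" and \<tau>: "\<tau> < \<gamma> \<alpha>"
  shows "\<exists>n\<ge>1. \<forall>k y. admissible l \<alpha> (\<lambda>i. z (i + n - 1)) k y \<longrightarrow>
    \<tau> * (\<Sum>i=1..k. norm (y i)) \<le> norm (\<Sum>i=1..k. y i)"
proof -
  have z: "unique_expansions z"
    using st basic_seq_unique_expansions by (auto simp: Delta_stabilizes_def)
  obtain \<epsilon> where \<epsilon>: "\<epsilon> \<longlonglongrightarrow> 0" and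
    "\<forall>\<alpha>. \<exists>m\<ge>1. \<forall>n\<ge>m. \<forall>y. block_basis (\<lambda>i. z (i + n - 1)) y \<longrightarrow> \<bar>delta l \<alpha> y - \<gamma> \<alpha>\<bar> < \<epsilon> n"
    using st unfolding Delta_stabilizes_def by blast
  then obtain m where m: "m \<ge> 1"
    "\<And>n y. n \<ge> m \<Longrightarrow> block_basis (\<lambda>i. z (i + n - 1)) y \<Longrightarrow> \<bar>delta l \<alpha> y - \<gamma> \<alpha>\<bar> < \<epsilon> n" by metis
  have "eventually (\<lambda>n. \<epsilon> n < \<gamma> \<alpha> - \<tau>) sequentially" using \<epsilon> \<tau> by (intro order_tendstoD) auto
  then obtain n0 where n0: "\<And>n. n \<ge> n0 \<Longrightarrow> \<epsilon> n < \<gamma> \<alpha> - \<tau>" by (auto simp: eventually_sequentially)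
  define n where "n = max m n0"
  have n: "n \<ge> 1" using m(1) by (simp add: n_def)
  let ?t = "\<lambda>i. z (i + n - 1)"
  have t: "unique_expansions ?t" by (rule unique_expansions_tail[OF z n])
  \<comment> \<open>The tail is a block basis of itself, so stabilization bounds its own \<delta>
    from below.\<close>
  have "block_basis ?t ?t"
    unfolding block_on_def using supp_self[OF t] unique_expansions_nonzero[OF t]
    by (auto intro: span_base)
  then have "\<tau> < delta l \<alpha> ?t" using m(2)[of n ?t] n0[of n] by (simp add: n_def abs_less_iff)
  then obtain d where d: "\<tau> < d" "0 \<le> d"
    "\<And>k y. admissible l \<alpha> ?t k y \<Longrightarrow> d * (\<Sum>i=1..k. norm (y i)) \<le> norm (\<Sum>i=1..k. y i)"
    unfolding delta_def by (elim less_cSupD[rotated, THEN bexE]) (auto intro!: exI[of _ "0::real"])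
  have "\<tau> * (\<Sum>i=1..k. norm (y i)) \<le> norm (\<Sum>i=1..k. y i)" if "admissible l \<alpha> ?t k y" for k y
    using d(3)[OF that] mult_right_mono[of \<tau> d "\<Sum>i=1..k. norm (y i)"] d(1)
    by (meson less_imp_le norm_ge_zero order_trans sum_nonneg)
  then show ?thesis using n by blast
qed

section \<open>Almost monotone block sequences\<close>

text \<open>\<open>mazur_step\<close> is iterated with losses written as ratios of successive values
  of \<rho>, so that they telescope. The starting positions N are prescribed to let each vector lie
  as far out as the later l_1 estimates demand.\<close>

lemma almost_monotone_block_sequence:
  fixes z :: "nat \<Rightarrow> 'a::banach" and \<rho> :: "nat \<Rightarrow> real"
  assumes z: "unique_expansions z" and \<kappa>: "0 < \<kappa>"
    and sep: "\<And>i j. q\<^sub>0 \<le> i \<Longrightarrow> i < j \<Longrightarrow> \<kappa> \<le> norm (z i /\<^sub>R norm (z i) - z j /\<^sub>R norm (z j))"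
    and \<rho>: "\<And>n. 0 < \<rho> n" "\<And>n. \<rho> (Suc n) < \<rho> n"
  shows "\<exists>x. \<forall>n\<ge>1. norm (x n) = 1 \<and> x n \<in> span (z ` {Suc (N n)..}) \<and>
    (\<forall>k\<in>{1..<n}. set_less (supp z (x k)) (supp z (x n))) \<and>
    (\<forall>h\<in>span (x ` {1..<n}). \<forall>t. \<rho> n / \<rho> (n - 1) * norm h \<le> norm (h + t *\<^sub>R x n))"
proof -
  define P where "P f n r \<longleftrightarrow> (1 \<le> n \<longrightarrow> norm r = 1 \<and> r \<in> span (z ` {Suc (N n)..}) \<and>
    (\<forall>k\<in>{1..<n}. set_less (supp z (f k)) (supp z r)) \<and>
    (\<forall>h\<in>span (f ` {1..<n}). \<forall>t. \<rho> n / \<rho> (n - 1) * norm h \<le> norm (h + t *\<^sub>R r)))" for f n r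
  have "\<exists>f. \<forall>n. P f n (f n)"
  proof (rule dependent_wellorder_choice)
    fix r f g and n :: nat
    assume eq: "\<And>y. y < n \<Longrightarrow> f y = (g y :: 'a)"
    then have "f ` {1..<n} = g ` {1..<n}" "\<forall>k\<in>{1..<n}. f k = g k" by auto
    then show "P f n r = P g n r" by (simp add: P_def)
  next
    fix n :: nat and f
    assume prev: "\<And>y. y < n \<Longrightarrow> P f y (f y)"
    show "\<exists>r. P f n r"
    proof (cases "1 \<le> n")
      case n: True
      have fin: "finite (supp z (f k))" if "k \<in> {1..<n}" for k
      proof -
        have "f k \<in> span (z ` {Suc (N k)..})" using prev[of k] that by (simp add: P_def)
        then show ?thesis by (rule supp_span(1)[OF z]) auto
      qed
      have finU: "finite (\<Union>k\<in>{1..<n}. supp z (f k))" using fin by blast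
      \<comment> \<open>Beyond q the normalized terms are separated, the prescribed start is passed
        and all earlier supports have ended.\<close>
      define q where "q = Suc (q\<^sub>0 + N n + Max (insert 0 (\<Union>k\<in>{1..<n}. supp z (f k))))"
      have q: "p < q" if "k \<in> {1..<n}" "p \<in> supp z (f k)" for p k
      proof -
        have "p \<le> Max (insert 0 (\<Union>k\<in>{1..<n}. supp z (f k)))" using finU that by (intro Max_ge) auto
        then show ?thesis by (simp add: q_def)
      qed
      define w where "w i = z (i + q) /\<^sub>R norm (z (i + q))" for i
      have w1: "norm (w i) = 1" for i
        using unique_expansions_nonzero[OF z, of "i + q"] by (simp add: w_def q_def)
      have ws: "\<kappa> \<le> norm (w i - w j)" if "i < j" for i j
        unfolding w_def using that by (intro sep) (auto simp: q_def)
      have n': "Suc (n - 1) = n" using n by simp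
      have \<eta>: "0 < 1 - \<rho> n / \<rho> (n - 1)"
        using \<rho>(1)[of "n - 1"] \<rho>(2)[of "n - 1"] unfolding n' by simp
      obtain r where r: "r \<in> span (range w)" "norm r = 1"
        "\<And>h t. h \<in> span (f ` {1..<n}) \<Longrightarrow> (1 - (1 - \<rho> n / \<rho> (n - 1))) * norm h \<le> norm (h + t *\<^sub>R r)"
        using mazur_step[where w = w and F = "f ` {1..<n}" and \<kappa> = \<kappa>, OF _ w1 \<kappa> ws \<eta>] by auto
      have "range w \<subseteq> span (z ` {q..})" by (auto simp: w_def intro!: span_scale intro: span_base)
      then have rq: "r \<in> span (z ` {q..})" using r(1) span_minimal[OF _ subspace_span] by blast
      then have "supp z r \<subseteq> {q..}" by (rule supp_span(2)[OF z]) (auto simp: q_def)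
      then have "\<forall>k\<in>{1..<n}. set_less (supp z (f k)) (supp z r)"
        using q unfolding set_less_def by (meson atLeast_iff less_le_trans subsetD)
      moreover have "z ` {q..} \<subseteq> z ` {Suc (N n)..}" by (intro image_mono) (auto simp: q_def)
      then have "r \<in> span (z ` {Suc (N n)..})" using rq span_mono by blast
      ultimately have "P f n r" using r by (simp add: P_def)
      then show ?thesis by blast
    qed (simp add: P_def)
  qed
  then show ?thesis unfolding P_def by blast
qed

text \<open>Removing the vectors after A one at a time multiplies the losses to
  \<open>\<rho> M / \<rho> p\<close>, which is at least b because \<rho> lies between b and
  1.\<close>

lemma almost_monotone_head:
  fixes x :: "nat \<Rightarrow> 'a::banach"
  assumes step: "\<And>n h t. 1 \<le> n \<Longrightarrow> h \<in> span (x ` {1..<n}) \<Longrightarrow> \<rho> n / \<rho> (n - 1) * norm h \<le> norm (h + t *\<^sub>R x n)"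
    and \<rho>: "\<And>n. 0 < \<rho> n" "\<And>n. \<rho> n \<le> 1" "\<And>n. b \<le> \<rho> n"
    and A: "finite A" "A \<subseteq> {1..}" "u \<in> span (x ` A)"
    and B: "finite B" "B \<subseteq> {1..}" "v \<in> span (x ` B)"
    and less: "set_less A B"
  shows "b * norm u \<le> norm (u + v)"
proof (cases "A = {}")
  case True
  then show ?thesis using A(3) by simp
next
  case False
  define p where "p = Max A"
  have u: "u \<in> span (x ` {1..p})"
  proof -
    have "A \<subseteq> {1..p}" using A(1,2) by (auto simp: p_def)
    then show ?thesis using A(3) span_mono[of "x ` A" "x ` {1..p}"] by blast
  qed
  have main: "\<rho> M * norm u \<le> \<rho> p * norm (u + v)" if "p \<le> M" "v \<in> span (x ` {p<..M})" for M v
    using that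
  proof (induction M arbitrary: v rule: dec_induct)
    case base
    then show ?case by simp
  next
    case (step M)
    have "{p<..Suc M} = insert (Suc M) {p<..M}" using step.hyps by auto
    then obtain t where t: "v - t *\<^sub>R x (Suc M) \<in> span (x ` {p<..M})"
      using step.prems span_breakdown_eq[of v "x (Suc M)" "x ` {p<..M}"] by auto
    define v' where "v' = v - t *\<^sub>R x (Suc M)"
    have "x ` {p<..M} \<subseteq> x ` {1..<Suc M}" "x ` {1..p} \<subseteq> x ` {1..<Suc M}" using step.hyps by auto
    then have "u + v' \<in> span (x ` {1..<Suc M})"
      using u t unfolding v'_def by (meson span_add span_mono subsetD)
    then have "\<rho> (Suc M) / \<rho> M * norm (u + v') \<le> norm (u + v' + t *\<^sub>R x (Suc M))"
      using assms(1)[of "Suc M" "u + v'" t] by simp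
    then have 1: "\<rho> (Suc M) * norm (u + v') \<le> \<rho> M * norm (u + v)"
      using \<rho>(1)[of M] by (simp add: v'_def field_simps)
    have "\<rho> (Suc M) * (\<rho> M * norm u) \<le> \<rho> (Suc M) * (\<rho> p * norm (u + v'))"
      using step.IH[of v'] t \<rho>(1)[of "Suc M"] by (intro mult_left_mono) (auto simp: v'_def)
    also have "\<dots> = \<rho> p * (\<rho> (Suc M) * norm (u + v'))" by simp
    also have "\<dots> \<le> \<rho> p * (\<rho> M * norm (u + v))"
      using 1 \<rho>(1)[of p] by (intro mult_left_mono) auto
    finally have "\<rho> M * (\<rho> (Suc M) * norm u) \<le> \<rho> M * (\<rho> p * norm (u + v))"
      by (simp add: mult_ac)
    then show ?case using \<rho>(1)[of M] by simp
  qed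
  define M where "M = Max (insert p B)"
  have "B \<subseteq> {p<..M}"
    using less B(1) Max_in[OF A(1) False] by (auto simp: M_def p_def set_less_def)
  then have "v \<in> span (x ` {p<..M})" using B(3) span_mono[of "x ` B"] by blast
  moreover have "p \<le> M" using B(1) by (simp add: M_def)
  ultimately have "\<rho> M * norm u \<le> \<rho> p * norm (u + v)" by (intro main)
  moreover have "b * norm u \<le> \<rho> M * norm u" by (intro mult_right_mono \<rho>(3)) simp
  moreover have "\<rho> p * norm (u + v) \<le> 1 * norm (u + v)" by (intro mult_right_mono \<rho>(2)) simp
  ultimately show ?thesis by linarith
qed

text \<open>The difference of two expansions of one vector has partial sums tending to 0, and each
  partial sum is controlled by all later ones. Hence all of them vanish, and so does every
  coefficient.\<close>

lemma unique_expansions_if_head_estimate: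
  fixes x :: "nat \<Rightarrow> 'a::banach"
  assumes head: "\<And>A B u v. finite A \<Longrightarrow> A \<subseteq> {1..} \<Longrightarrow> u \<in> span (x ` A) \<Longrightarrow>
      finite B \<Longrightarrow> B \<subseteq> {1..} \<Longrightarrow> v \<in> span (x ` B) \<Longrightarrow> set_less A B \<Longrightarrow> b * norm u \<le> norm (u + v)"
    and b: "0 < b" and x: "\<And>n. 1 \<le> n \<Longrightarrow> x n \<noteq> 0"
  shows "unique_expansions x"
  unfolding unique_expansions_def
proof (intro ballI allI impI)
  fix v c d assume c: "expansion x c v" and d: "expansion x d v"
  define g where "g i = c i - d i" for i
  have g0: "g 0 = 0" using c d by (simp add: expansion_def g_def)
  have "(\<lambda>i. c i *\<^sub>R x i - d i *\<^sub>R x i) sums (v - v)"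
    using c d by (intro sums_diff) (auto simp: expansion_def)
  then have "(\<lambda>i. g i *\<^sub>R x i) sums 0" by (simp add: g_def scaleR_diff_left)
  then have lim: "(\<lambda>n. \<Sum>i<n. g i *\<^sub>R x i) \<longlonglongrightarrow> 0" by (simp add: sums_def)
  define s where "s n = (\<Sum>i<n. g i *\<^sub>R x i)" for n
  have s0: "s p = 0" for p
  proof -
    have "b * norm (s p) \<le> norm (s n)" if "n \<ge> p" for n
    proof -
      have in_span: "(\<Sum>i\<in>Q. g i *\<^sub>R x i) \<in> span (x ` Q)" for Q
        by (intro span_sum span_scale span_base) auto
      have "g i = 0" if "i \<notin> {1..<p}" "i < p" for i using that g0 by (cases i) auto
      then have sp: "s p = (\<Sum>i\<in>{1..<p}. g i *\<^sub>R x i)"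
        unfolding s_def by (intro sum.mono_neutral_right) auto
      have "s n = s p + (\<Sum>i\<in>{p..<n} - {0}. g i *\<^sub>R x i)"
      proof -
        have "s n = (\<Sum>i\<in>{..<p} \<union> {p..<n}. g i *\<^sub>R x i)"
          unfolding s_def using that by (intro sum.cong) auto
        also have "\<dots> = s p + (\<Sum>i\<in>{p..<n}. g i *\<^sub>R x i)"
          unfolding s_def by (intro sum.union_disjoint) auto
        also have "(\<Sum>i\<in>{p..<n}. g i *\<^sub>R x i) = (\<Sum>i\<in>{p..<n} - {0}. g i *\<^sub>R x i)"
          using g0 by (intro sum.mono_neutral_right) auto
        finally show ?thesis .
      qed
      moreover have "b * norm (\<Sum>i\<in>{1..<p}. g i *\<^sub>R x i) \<le>
          norm ((\<Sum>i\<in>{1..<p}. g i *\<^sub>R x i) + (\<Sum>i\<in>{p..<n} - {0}. g i *\<^sub>R x i))"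
        by (rule head[OF _ _ in_span _ _ in_span]) (auto simp: set_less_def)
      ultimately show ?thesis using sp by simp
    qed
    then have "b * norm (s p) \<le> 0"
      using tendsto_norm[OF lim] unfolding s_def[symmetric]
      by (intro LIMSEQ_le_const[of "\<lambda>n. norm (s n)"]) auto
    then show ?thesis using b by (simp add: mult_le_0_iff)
  qed
  have "g p = 0" for p
  proof (cases "p = 0")
    case False
    have "s (Suc p) = s p + g p *\<^sub>R x p" by (simp add: s_def)
    then show ?thesis using s0 x[of p] False by simp
  qed (use g0 in simp)
  then show "c = d" by (simp add: g_def fun_eq_iff)
qed

section \<open>The lower Tsirelson estimate for block sequences\<close>

text \<open>Both claims of the theorem are instances: \<open>R i = {i}\<close> for the terms
  themselves, and supports indexed by their minima for blocks. Because of
  \<open>R i \<subseteq> {i..}\<close>, a piece starting at m involves only x_r with r \<ge> m,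
  which is where the estimate at m is valid.\<close>

lemma tsirelson_norm_lower_estimate:
  fixes x :: "nat \<Rightarrow> 'a::banach" and Y :: "nat \<Rightarrow> 'a"
  assumes N: "is_tsirelson_norm \<theta> N" and \<theta>: "0 < \<theta>" "\<theta> < 1" and e: "0 < e" "2 * e \<le> 1 - \<theta>"
    and z: "unique_expansions z" and x: "\<And>r. 1 \<le> r \<Longrightarrow> x r \<in> span (z ` {Suc (N\<^sub>0 r)..})"
    and xless: "\<And>r s. 1 \<le> r \<Longrightarrow> r < s \<Longrightarrow> set_less (supp z (x r)) (supp z (x s))"
    and n: "\<And>m. 1 \<le> n m" and N\<^sub>0: "\<And>m r. m \<le> r \<Longrightarrow> n m + 2 * m \<le> N\<^sub>0 r"
    and tail: "\<And>m k y. admissible l 1 (\<lambda>i. z (i + n m - 1)) k y \<Longrightarrow>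
      \<theta> * (1 - e - e / real (Suc m)) / (1 - e - e / real (Suc (Suc m))) * (\<Sum>i=1..k. norm (y i))
        \<le> norm (\<Sum>i=1..k. y i)"
    and head: "\<And>A B u v. finite A \<Longrightarrow> A \<subseteq> {1..} \<Longrightarrow> u \<in> span (x ` A) \<Longrightarrow>
      finite B \<Longrightarrow> B \<subseteq> {1..} \<Longrightarrow> v \<in> span (x ` B) \<Longrightarrow> set_less A B \<Longrightarrow> (1 - e) * norm u \<le> norm (u + v)"
    and S: "finite S" "S \<subseteq> {1..}" and Y: "\<And>i. i \<in> S \<Longrightarrow> Y i \<in> span (x ` R i)"
    and R: "\<And>i. i \<in> S \<Longrightarrow> finite (R i)" "\<And>i. i \<in> S \<Longrightarrow> R i \<subseteq> {i..}"
      "\<And>i j. i \<in> S \<Longrightarrow> j \<in> S \<Longrightarrow> i < j \<Longrightarrow> set_less (R i) (R j)"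
    and a: "a \<in> c00" "{i. a i \<noteq> 0} \<subseteq> S" "\<And>i. i \<in> S \<Longrightarrow> \<bar>a i\<bar> \<le> norm (Y i)"
  shows "1 / 2 * (1 - 3 * e) * N a \<le> norm (\<Sum>i\<in>S. Y i)"
proof (cases "S = {}")
  case True
  then have "a = (\<lambda>_. 0)" using a(2) by auto
  moreover have "N a = 0 \<longleftrightarrow> a = (\<lambda>_. 0)" using N a(1) unfolding is_tsirelson_norm_def norm_on_c00_def by blast
  ultimately show ?thesis using True by simp
next
  case False
  have e2: "2 * e < 1" using e \<theta> by linarith
  \<comment> \<open>c increases from 1 - 2 e towards 1 - e. The upper bound leaves room for the loss
    1 - e of almost monotonicity at the leaves; the ratios of successive values are those in
    \<open>tail\<close>.\<close>
  define c where "c m = 1 - e - e / real (Suc m)" for m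
  have c_low: "1 - 2 * e \<le> c m" and c_high: "c m \<le> 1 - e" for m
    using e by (auto simp: c_def field_simps)
  have c_pos: "0 < c m" for m using c_low[of m] e2 by linarith
  have c_inc: "incseq c"
    using e by (intro incseq_SucI) (simp add: c_def frac_le)
  have c_step: "\<theta> * c (Suc m) \<le> c m" for m
  proof -
    have "\<theta> * c (Suc m) \<le> \<theta> * 1" using \<theta> e c_high[of "Suc m"] by (intro mult_left_mono) auto
    also have "\<dots> \<le> c m" using c_low[of m] e by simp
    finally show ?thesis .
  qed
  define f where "f D = norm (\<Sum>i\<in>D. Y i)" for D
  have R1: "R i \<subseteq> {1..}" if "i \<in> S" for i using R(2)[OF that] S(2) that by (force simp: subset_iff)
  have sumY: "(\<Sum>i\<in>D. Y i) \<in> span (x ` (\<Union>i\<in>D. R i))" if "D \<subseteq> S" for D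
  proof (rule span_sum)
    fix i assume i: "i \<in> D"
    then show "Y i \<in> span (x ` (\<Union>i\<in>D. R i))"
      using Y[of i] that span_mono[of "x ` R i" "x ` (\<Union>i\<in>D. R i)"] by blast
  qed
  have headY: "(1 - e) * f A \<le> f (A \<union> B)" if AB: "A \<subseteq> S" "B \<subseteq> S" "set_less A B" for A B
  proof -
    have fin: "finite A" "finite B" using AB S(1) finite_subset by auto
    have "A \<inter> B = {}" using AB(3) by (auto simp: set_less_def)
    then have eq: "(\<Sum>i\<in>A \<union> B. Y i) = (\<Sum>i\<in>A. Y i) + (\<Sum>i\<in>B. Y i)"
      by (rule sum.union_disjoint[OF fin])
    show ?thesis
      unfolding f_def eq
    proof (rule head[OF _ _ sumY[OF AB(1)] _ _ sumY[OF AB(2)]])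
      show "set_less (\<Union>i\<in>A. R i) (\<Union>i\<in>B. R i)"
        unfolding set_less_def
      proof (intro ballI)
        fix p q assume "p \<in> (\<Union>i\<in>A. R i)" "q \<in> (\<Union>i\<in>B. R i)"
        then obtain i j where ij: "i \<in> A" "j \<in> B" "p \<in> R i" "q \<in> R j" by blast
        then have "set_less (R i) (R j)" using R(3)[of i j] AB by (auto simp: set_less_def)
        then show "p < q" using ij by (simp add: set_less_def)
      qed
    qed (use fin R(1) R1 AB in auto)
  qed
  have leaf: "c k * \<bar>a m\<bar> \<le> f I" if I: "I \<subseteq> S" "m \<in> I" "\<And>i. i \<in> I \<Longrightarrow> m \<le> i" for I m k
  proof -
    have "c k * \<bar>a m\<bar> \<le> (1 - e) * norm (Y m)"
      using c_high[of k] a(3)[of m] I e e2 by (intro mult_mono) auto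
    also have "\<dots> = (1 - e) * f {m}" by (simp add: f_def)
    also have "\<dots> \<le> f ({m} \<union> (I - {m}))"
      using I by (intro headY) (auto simp: set_less_def order.strict_iff_order)
    also have "{m} \<union> (I - {m}) = I" using I(2) by blast
    finally show ?thesis .
  qed
  have node: "c m * \<theta> * (\<Sum>E\<in>\<E>. f E) \<le> c (Suc m) * f (\<Union>\<E>)"
    if E: "finite \<E>" "separated \<E>" "\<Union>\<E> \<subseteq> S \<inter> {m..}" "1 \<le> m" "card \<E> \<le> 2 * m" for \<E> m
  proof -
    let ?w = "\<lambda>i. z (i + n m - 1)"
    \<comment> \<open>\<open>G E\<close> holds positions with respect to z; \<open>H E\<close> holds
      the same positions after the tail from \<open>n m\<close> on is renumbered from 1.\<close>
    define G where "G E = (\<Union>i\<in>E. \<Union>r\<in>R i. supp z (x r))" for E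
    define H where "H E = (\<lambda>p. p - (n m - 1)) ` G E" for E
    have xspan: "x r \<in> span (z ` supp z (x r))" and xsupp: "supp z (x r) \<subseteq> {Suc (N\<^sub>0 r)..}" if "1 \<le> r" for r
      using supp_span(2,3)[OF z x[OF that]] by auto
    \<comment> \<open>The surplus \<open>2 * m\<close> survives the renumbering and leaves room for
      the \<open>2 * m\<close> pieces of a node with its first child absorbed.\<close>
    have GE: "p \<ge> n m + 2 * m" if Ep: "E \<in> \<E>" "p \<in> G E" for E p
    proof -
      obtain i r where ir: "i \<in> E" "r \<in> R i" "p \<in> supp z (x r)" using Ep(2) by (auto simp: G_def)
      have i: "i \<in> S" "m \<le> i" using ir(1) Ep(1) E(3) by auto
      have r: "m \<le> r" using R(2)[OF i(1)] ir(2) i(2) by auto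
      then have "Suc (N\<^sub>0 r) \<le> p" using xsupp[of r] ir(3) E(4) by auto
      then show ?thesis using N\<^sub>0[OF r] by simp
    qed
    have Gless: "set_less (G E) (G E')" if sub: "E \<in> \<E>" "E' \<in> \<E>" and less: "set_less E E'" for E E'
      unfolding set_less_def
    proof (intro ballI)
      fix p q assume "p \<in> G E" "q \<in> G E'"
      then obtain i j r s where *: "i \<in> E" "r \<in> R i" "p \<in> supp z (x r)" "j \<in> E'" "s \<in> R j" "q \<in> supp z (x s)"
        by (auto simp: G_def)
      then have ij: "i < j" "i \<in> S" "j \<in> S" using less E(3) sub by (auto simp: set_less_def)
      then have "r < s" "1 \<le> r" using R(3)[OF ij(2,3,1)] R1[OF ij(2)] * by (auto simp: set_less_def)
      then show "p < q" using xless[of r s] * by (auto simp: set_less_def)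
    qed
    have Hless: "set_less (H E) (H E')" if "E \<in> \<E>" "E' \<in> \<E>" "set_less E E'" for E E'
      unfolding set_less_def
    proof (intro ballI)
      fix p q assume "p \<in> H E" "q \<in> H E'"
      then obtain p' q' where pq: "p' \<in> G E" "q' \<in> G E'" "p = p' - (n m - 1)" "q = q' - (n m - 1)"
        by (auto simp: H_def)
      then have "p' < q'" using Gless[OF that] by (simp add: set_less_def)
      then show "p < q" using GE[OF that(1) pq(1)] pq(3,4) by linarith
    qed
    have V: "(\<Sum>i\<in>E. Y i) \<in> span (?w ` H E)" if EE: "E \<in> \<E>" for E
    proof -
      have ES: "E \<subseteq> S" using E(3) EE by blast
      have "?w ` H E = z ` G E"
        unfolding H_def image_image
      proof (rule image_cong[OF refl])
        fix p assume "p \<in> G E"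
        then have "p - (n m - 1) + n m - 1 = p" using GE[OF EE, of p] n[of m] by linarith
        then show "z (p - (n m - 1) + n m - 1) = z p" by (rule arg_cong)
      qed
      moreover have "x ` (\<Union>i\<in>E. R i) \<subseteq> span (z ` G E)"
      proof
        fix v assume "v \<in> x ` (\<Union>i\<in>E. R i)"
        then obtain i r where ir: "i \<in> E" "r \<in> R i" "v = x r" by blast
        then have "1 \<le> r" using R1[of i] ES by auto
        then have "v \<in> span (z ` supp z (x r))" using xspan ir(3) by simp
        moreover have "z ` supp z (x r) \<subseteq> z ` G E" using ir by (auto simp: G_def)
        ultimately show "v \<in> span (z ` G E)" using span_mono by blast
      qed
      ultimately have "span (x ` (\<Union>i\<in>E. R i)) \<subseteq> span (?w ` H E)"
        using span_minimal[OF _ subspace_span, of "x ` (\<Union>i\<in>E. R i)" "z ` G E"] by (simp only:)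
      then show ?thesis using sumY[OF ES] by (rule subsetD)
    qed
    have "\<theta> * c m / c (Suc m) * (\<Sum>E\<in>\<E>. norm (\<Sum>i\<in>E. Y i)) \<le> norm (\<Sum>E\<in>\<E>. \<Sum>i\<in>E. Y i)"
    proof (rule l1_lower_estimate_separated[OF unique_expansions_tail[OF z n] _ E(1,5), where H = H])
      show "\<theta> * c m / c (Suc m) * (\<Sum>i=1..k. norm (y i)) \<le> norm (\<Sum>i=1..k. y i)"
        if "admissible l 1 ?w k y" for k y
        unfolding c_def by (rule tail[OF that])
      show "H E \<subseteq> {2 * m..}" if "E \<in> \<E>" for E using GE[OF that] by (force simp: H_def)
      show "set_less (H E) (H E') \<or> set_less (H E') (H E)" if "E \<in> \<E>" "E' \<in> \<E>" "E \<noteq> E'" for E E'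
        using E(2) that Hless unfolding separated_def by meson
    qed (use V E(4) in auto)
    also have "(\<Sum>E\<in>\<E>. \<Sum>i\<in>E. Y i) = (\<Sum>i\<in>\<Union>\<E>. Y i)"
    proof (rule sum.Union_disjoint[symmetric, unfolded o_def])
      show "\<forall>A\<in>\<E>. finite A" using E(3) S(1) by (meson Sup_le_iff finite_Int finite_subset)
      show "\<forall>A\<in>\<E>. \<forall>B\<in>\<E>. A \<noteq> B \<longrightarrow> A \<inter> B = {}"
        using E(2) unfolding separated_def set_less_def by (metis disjoint_iff less_irrefl)
    qed
    finally show ?thesis using c_pos[of "Suc m"] by (simp add: f_def field_simps)
  qed
  define F where "F = norm (\<Sum>i\<in>S. Y i)"
  have root: "(1 - 3 * e) * s \<le> 2 * F" if s: "0 \<le> s" "s < N a" for s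
  proof -
    obtain m where m: "m \<in> S" "c m * s \<le> f (S \<inter> {m..})"
      using tsirelson_lower_estimate[OF N \<theta> a(1) S False a(2) c_inc less_imp_le[OF c_pos] c_step leaf node s(2)]
      by blast
    \<comment> \<open>The part before m has norm at most F / (1 - e), so the part from m on has norm
      at most F + F / (1 - e). This is the source of the factor 1/2.\<close>
    have "S = (S \<inter> {..<m}) \<union> (S \<inter> {m..})" by auto
    then have "(1 - e) * f (S \<inter> {..<m}) \<le> F"
      unfolding F_def f_def[symmetric] using headY[of "S \<inter> {..<m}" "S \<inter> {m..}"] by (auto simp: set_less_def)
    moreover have "f (S \<inter> {m..}) \<le> F + f (S \<inter> {..<m})"
    proof -
      have "(\<Sum>i\<in>S. Y i) = (\<Sum>i\<in>S \<inter> {..<m}. Y i) + (\<Sum>i\<in>S \<inter> {m..}. Y i)"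
        using S(1) by (subst sum.union_disjoint[symmetric]) (auto intro!: sum.cong)
      then show ?thesis unfolding F_def f_def
        using norm_triangle_ineq4[of "\<Sum>i\<in>S. Y i" "\<Sum>i\<in>S \<inter> {..<m}. Y i"] by simp
    qed
    then have "(1 - e) * f (S \<inter> {m..}) \<le> (1 - e) * (F + f (S \<inter> {..<m}))"
      using e2 e by (intro mult_left_mono) auto
    ultimately have "(1 - e) * f (S \<inter> {m..}) \<le> (2 - e) * F" by (simp add: algebra_simps)
    also have "\<dots> \<le> 2 * F" using e by (intro mult_right_mono) (auto simp: F_def)
    finally have "(1 - e) * f (S \<inter> {m..}) \<le> 2 * F" .
    moreover have "(1 - e) * ((1 - 2 * e) * s) \<le> (1 - e) * f (S \<inter> {m..})"
      using m(2) mult_right_mono[OF c_low[of m] s(1)] e e2 by (intro mult_left_mono) auto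
    \<comment> \<open>The 3 collects one e from cutting off the initial segment and two from the
      lower bound of c.\<close>
    moreover have "(1 - 3 * e) * s \<le> (1 - e) * ((1 - 2 * e) * s)"
      using e s(1) by (simp add: algebra_simps)
    ultimately show ?thesis by linarith
  qed
  show ?thesis
  proof (rule ccontr)
    assume "\<not> ?thesis"
    then have *: "2 * F < (1 - 3 * e) * N a" by (simp add: F_def)
    have "0 \<le> F" by (simp add: F_def)
    then have "0 < (1 - 3 * e) * N a" using * by linarith
    moreover have "0 \<le> N a" using N a(1) unfolding is_tsirelson_norm_def norm_on_c00_def by blast
    ultimately have pos: "0 < 1 - 3 * e" "0 < N a" by (auto simp: zero_less_mult_iff)
    \<comment> \<open>The midpoint between the value that \<open>root\<close> allows and
      \<open>N a\<close>: an s strictly below \<open>N a\<close> that still contradicts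
      \<open>root\<close>.\<close>
    define s where "s = (2 * F / (1 - 3 * e) + N a) / 2"
    have "2 * F / (1 - 3 * e) < N a" using * pos by (simp add: field_simps)
    moreover have "0 \<le> 2 * F / (1 - 3 * e)" using pos \<open>0 \<le> F\<close> by simp
    ultimately have s: "0 \<le> s" "s < N a" "2 * F / (1 - 3 * e) < s" by (auto simp: s_def)
    then have "2 * F < (1 - 3 * e) * s" using pos by (simp add: field_simps)
    then show False using root[OF s(1,2)] by simp
  qed
qed

section \<open>Choice of the parameters and conclusion\<close>

theorem theorem5p9:
  fixes u z :: "nat \<Rightarrow> 'a::banach"
    and l :: "omega1 \<Rightarrow> nat \<Rightarrow> omega1"
    and \<gamma> :: "omega1 \<Rightarrow> real"
  assumes "fundamental_seqs l"
    and "schauder_basis u"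
    and "asymptotic_l1 u"
    and "block_basis u z"
    and "basic_seq z"
    and "\<gamma> \<in> Delta l u"
    and "Delta_stabilizes l z \<gamma>"
    and "0 < \<gamma> 1" "\<gamma> 1 < 1"
  shows "\<forall>\<epsilon>>0. \<exists>x. block_basis z x \<and> (\<forall>i\<ge>1. norm (x i) = 1) \<and>
    (\<forall>a\<in>c00. norm (\<Sum>i | a i \<noteq> 0. a i *\<^sub>R x i) \<ge>
        1 / 2 * (1 - \<epsilon>) * tsirelson_norm (\<gamma> 1) (\<lambda>j. \<Sum>i | a i \<noteq> 0. a i * unit_vec i j)) \<and>
    (\<forall>k y m. block_on x {1..k} y \<and> (\<forall>i\<in>{1..k}. m i = Min (supp x (y i))) \<longrightarrow>
        norm (\<Sum>i=1..k. y i) \<ge>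
        1 / 2 * (1 - \<epsilon>) * tsirelson_norm (\<gamma> 1) (\<lambda>j. \<Sum>i=1..k. norm (y i) * unit_vec (m i) j))"
proof (intro allI impI)
  fix \<epsilon> :: real assume \<epsilon>: "0 < \<epsilon>"
  define \<theta> where "\<theta> = \<gamma> 1"
  have \<theta>: "0 < \<theta>" "\<theta> < 1" using assms(8,9) by (auto simp: \<theta>_def)
  define N where "N = tsirelson_norm \<theta>"
  have N: "is_tsirelson_norm \<theta> N"
    unfolding N_def tsirelson_norm_def by (rule someI_ex[OF tsirelson_norm_exists[OF \<theta>]])
  define e where "e = min (\<epsilon> / 3) ((1 - \<theta>) / 2)"
  have e: "0 < e" "2 * e \<le> 1 - \<theta>" "3 * e \<le> \<epsilon>" using \<epsilon> \<theta> by (auto simp: e_def min_def field_simps)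
  have z: "unique_expansions z" by (rule basic_seq_unique_expansions[OF assms(5)])
  \<comment> \<open>Lying strictly below \<theta>, each \<open>d m\<close> is attained as a lower
    l_1 constant on some tail of z, which starts at \<open>n m\<close>.\<close>
  define d where "d m = \<theta> * (1 - e - e / real (Suc m)) / (1 - e - e / real (Suc (Suc m)))" for m
  have d: "d m < \<theta>" for m
  proof -
    have "e / real (Suc (Suc m)) < e / real (Suc m)" using e(1) by (intro divide_strict_left_mono) auto
    moreover have "e / real (Suc (Suc m)) \<le> e" using e(1) by (simp add: field_simps)
    moreover have "2 * e < 1" using e \<theta> by linarith
    ultimately show ?thesis using \<theta> unfolding d_def by (subst pos_divide_less_eq) auto
  qed
  have "\<forall>m. \<exists>n\<ge>1. \<forall>k y. admissible l 1 (\<lambda>i. z (i + n - 1)) k y \<longrightarrow>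
    d m * (\<Sum>i=1..k. norm (y i)) \<le> norm (\<Sum>i=1..k. y i)"
    using Delta_stabilizes_tail[OF assms(7), of _ 1] d by (simp add: \<theta>_def)
  then obtain n where n: "\<And>m. 1 \<le> n m" and tail: "\<And>m k y. admissible l 1 (\<lambda>i. z (i + n m - 1)) k y \<Longrightarrow>
    d m * (\<Sum>i=1..k. norm (y i)) \<le> norm (\<Sum>i=1..k. y i)" by metis
  \<comment> \<open>Summing over all m \<le> r makes x_r lie beyond every tail that a piece
    containing r may have to use.\<close>
  define N\<^sub>0 where "N\<^sub>0 r = (\<Sum>m\<le>r. n m) + 2 * r" for r
  have N0: "n m + 2 * m \<le> N\<^sub>0 r" if "m \<le> r" for m r
    using member_le_sum[of m "{..r}" n] that by (simp add: N\<^sub>0_def)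
  \<comment> \<open>\<rho> decreases from 1 towards 1 - e, so the total loss of almost monotonicity
    is at most the factor 1 - e.\<close>
  define \<rho> where "\<rho> k = 1 - e + e / real (Suc k)" for k
  have e1: "e < 1" using e \<theta> by linarith
  have \<rho>: "0 < \<rho> k" "\<rho> k \<le> 1" "1 - e \<le> \<rho> k" "\<rho> (Suc k) < \<rho> k" for k
  proof -
    have "0 \<le> e / real (Suc k)" "e / real (Suc k) \<le> e" using e(1) by (auto simp: field_simps)
    then show "0 < \<rho> k" "\<rho> k \<le> 1" "1 - e \<le> \<rho> k" using e1 by (auto simp: \<rho>_def)
    show "\<rho> (Suc k) < \<rho> k" using e(1) unfolding \<rho>_def by (intro add_strict_left_mono divide_strict_left_mono) auto
  qed
  \<comment> \<open>The l_1 estimate for two blocks is applied to one normalized term and the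
    negative of the other.\<close>
  have sep: "2 * d 1 \<le> norm (z i /\<^sub>R norm (z i) - z j /\<^sub>R norm (z j))" if ij: "n 1 + 2 \<le> i" "i < j" for i j
  proof -
    let ?w = "\<lambda>i. z (i + n 1 - 1)"
    define V where "V p = (if p = i then z i /\<^sub>R norm (z i) else - (z j /\<^sub>R norm (z j)))" for p
    have nz: "z p \<noteq> 0" if "1 \<le> p" for p by (rule unique_expansions_nonzero[OF z that])
    have "d 1 * (\<Sum>p\<in>{i, j}. norm (V p)) \<le> norm (\<Sum>p\<in>{i, j}. V p)"
    proof (rule l1_lower_estimate_separated[OF unique_expansions_tail[OF z n[of 1]] tail[of 1],
        where K = 2 and H = "\<lambda>p. {p - (n 1 - 1)}"])
      show "V p \<in> span (?w ` {p - (n 1 - 1)})" if "p \<in> {i, j}" for p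
        using that ij n[of 1] by (auto simp: V_def intro!: span_scale span_neg intro: span_base)
    qed (use ij in \<open>auto simp: set_less_def card_insert_if\<close>)
    moreover have "norm (V i) = 1" "norm (V j) = 1" using nz[of i] nz[of j] ij by (auto simp: V_def)
    moreover have "V i + V j = z i /\<^sub>R norm (z i) - z j /\<^sub>R norm (z j)" using ij(2) by (simp add: V_def)
    ultimately show ?thesis using ij(2) by simp
  qed
  have d1: "0 < 2 * d 1" using \<theta> e by (simp add: d_def field_simps)
  obtain x where "\<forall>n\<ge>1. norm (x n) = 1 \<and> x n \<in> span (z ` {Suc (N\<^sub>0 n)..}) \<and>
    (\<forall>k\<in>{1..<n}. set_less (supp z (x k)) (supp z (x n))) \<and>
    (\<forall>h\<in>span (x ` {1..<n}). \<forall>t. \<rho> n / \<rho> (n - 1) * norm h \<le> norm (h + t *\<^sub>R x n))"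
    using almost_monotone_block_sequence[where q\<^sub>0 = "n 1 + 2" and N = N\<^sub>0 and \<rho> = \<rho>, OF z d1 sep \<rho>(1,4)]
    by blast
  then have x: "\<And>n. 1 \<le> n \<Longrightarrow> norm (x n) = 1" "\<And>n. 1 \<le> n \<Longrightarrow> x n \<in> span (z ` {Suc (N\<^sub>0 n)..})"
    "\<And>k n. 1 \<le> k \<Longrightarrow> k < n \<Longrightarrow> set_less (supp z (x k)) (supp z (x n))"
    "\<And>n h t. 1 \<le> n \<Longrightarrow> h \<in> span (x ` {1..<n}) \<Longrightarrow> \<rho> n / \<rho> (n - 1) * norm h \<le> norm (h + t *\<^sub>R x n)"
    by auto
  have head: "(1 - e) * norm u \<le> norm (u + v)" if "finite A" "A \<subseteq> {1..}" "u \<in> span (x ` A)"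
    "finite B" "B \<subseteq> {1..}" "v \<in> span (x ` B)" "set_less A B" for A B u v
    by (rule almost_monotone_head[OF x(4) \<rho>(1-3) that])
  have xnz: "x n \<noteq> 0" if "1 \<le> n" for n using x(1)[OF that] by auto
  have ux: "unique_expansions x"
    by (rule unique_expansions_if_head_estimate[OF head _ xnz]) (use e1 in auto)
  have lower: "1 / 2 * (1 - 3 * e) * N a \<le> norm (\<Sum>i\<in>S. Y i)"
    if "finite S" "S \<subseteq> {1..}" "\<And>i. i \<in> S \<Longrightarrow> Y i \<in> span (x ` R i)"
      "\<And>i. i \<in> S \<Longrightarrow> finite (R i)" "\<And>i. i \<in> S \<Longrightarrow> R i \<subseteq> {i..}"
      "\<And>i j. i \<in> S \<Longrightarrow> j \<in> S \<Longrightarrow> i < j \<Longrightarrow> set_less (R i) (R j)"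
      "a \<in> c00" "{i. a i \<noteq> 0} \<subseteq> S" "\<And>i. i \<in> S \<Longrightarrow> \<bar>a i\<bar> \<le> norm (Y i)" for S Y R a
  proof (rule tsirelson_norm_lower_estimate[where x = x and z = z and N\<^sub>0 = N\<^sub>0 and n = n and l = l
        and \<theta> = \<theta> and e = e and S = S and Y = Y and R = R and a = a])
    show "\<theta> * (1 - e - e / real (Suc m)) / (1 - e - e / real (Suc (Suc m))) * (\<Sum>i=1..k. norm (y i))
        \<le> norm (\<Sum>i=1..k. y i)" if "admissible l 1 (\<lambda>i. z (i + n m - 1)) k y" for m k y
      using tail[OF that] by (simp only: d_def)
    show "(1 - e) * norm u \<le> norm (u + v)" if "finite A" "A \<subseteq> {1..}" "u \<in> span (x ` A)"
      "finite B" "B \<subseteq> {1..}" "v \<in> span (x ` B)" "set_less A B" for A B u v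
      by (rule head[OF that])
  qed (fact N \<theta> e(1,2) z x(2,3) n N0 that)+
  have weaken: "1 / 2 * (1 - \<epsilon>) * N a \<le> 1 / 2 * (1 - 3 * e) * N a" if "a \<in> c00" for a
  proof -
    have "0 \<le> N a" using N that unfolding is_tsirelson_norm_def norm_on_c00_def by blast
    then show ?thesis using e(3) by (intro mult_right_mono) auto
  qed
  have bx: "block_basis z x"
    unfolding block_on_def
  proof (intro conjI ballI impI)
    fix i :: nat assume i: "i \<in> {1..}"
    have "z ` {Suc (N\<^sub>0 i)..} \<subseteq> z ` {1..}" by (intro image_mono) auto
    moreover have "x i \<in> span (z ` {Suc (N\<^sub>0 i)..})" using x(2) i by simp
    ultimately show "x i \<in> span (z ` {1..})" using span_mono by blast
    show "x i \<noteq> 0" using xnz i by auto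
    fix j :: nat assume j: "j \<in> {1..}" "i < j"
    have s: "finite (supp z (x k))" "supp z (x k) \<noteq> {}" if "1 \<le> k" for k
      using supp_span(1,4)[OF z x(2)[OF that]] xnz[OF that] by auto
    have "Max (supp z (x i)) \<in> supp z (x i)" "Min (supp z (x j)) \<in> supp z (x j)"
      using s[of i] s[of j] i j by auto
    then show "Max (supp z (x i)) < Min (supp z (x j))"
      using x(3)[of i j] i j by (auto simp: set_less_def)
  qed
  have part1: "1 / 2 * (1 - \<epsilon>) * N (\<lambda>j. \<Sum>i | a i \<noteq> 0. a i * unit_vec i j) \<le> norm (\<Sum>i | a i \<noteq> 0. a i *\<^sub>R x i)"
    if a: "a \<in> c00" for a
  proof -
    have fin: "finite {i. a i \<noteq> 0}" and "a 0 = 0" using a by (auto simp: c00_def)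
    then have pos: "{i. a i \<noteq> 0} \<subseteq> {1..}"
      by (metis (mono_tags, lifting) One_nat_def Suc_leI atLeast_iff gr0I mem_Collect_eq subsetI)
    have "(\<Sum>i | a i \<noteq> 0. a i * unit_vec i j) = a j" for j
    proof -
      have "(\<Sum>i | a i \<noteq> 0. a i * unit_vec i j) = (\<Sum>i | a i \<noteq> 0. if i = j then a j else 0)"
        by (rule sum.cong) (auto simp: unit_vec_def)
      then show ?thesis using fin by simp
    qed
    moreover have "1 / 2 * (1 - 3 * e) * N a \<le> norm (\<Sum>i | a i \<noteq> 0. a i *\<^sub>R x i)"
    proof (rule lower[OF fin pos, where R = "\<lambda>i. {i}"])
      show "a i *\<^sub>R x i \<in> span (x ` {i})" for i by (intro span_scale span_base) simp
      show "\<bar>a i\<bar> \<le> norm (a i *\<^sub>R x i)" if "i \<in> {i. a i \<noteq> 0}" for i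
        using x(1)[of i] that pos by auto
    qed (use a in \<open>auto simp: set_less_def\<close>)
    ultimately show ?thesis using weaken[OF a] by simp
  qed
  have part2: "1 / 2 * (1 - \<epsilon>) * N (\<lambda>j. \<Sum>i=1..k. norm (y i) * unit_vec (m i) j) \<le> norm (\<Sum>i=1..k. y i)"
    if y: "block_on x {1..k} y" and m: "\<forall>i\<in>{1..k}. m i = Min (supp x (y i))" for k y m
  proof -
    have ys: "finite (supp x (y i))" "supp x (y i) \<subseteq> {1..}" "y i \<in> span (x ` supp x (y i))" "supp x (y i) \<noteq> {}"
      if "i \<in> {1..k}" for i
      using supp_span[OF ux, of "y i" "{1..}"] y that by (auto simp: block_on_def)
    have mem: "m i \<in> supp x (y i)" "\<And>p. p \<in> supp x (y i) \<Longrightarrow> m i \<le> p" if "i \<in> {1..k}" for i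
      using ys[OF that] m that by auto
    have yless: "set_less (supp x (y i)) (supp x (y j))" if ij: "i \<in> {1..k}" "j \<in> {1..k}" "i < j" for i j
    proof -
      have "Max (supp x (y i)) < Min (supp x (y j))" using y ij by (auto simp: block_on_def)
      then show ?thesis using ys[OF ij(1)] ys[OF ij(2)]
        unfolding set_less_def by (meson Max_ge Min_le le_less_trans less_le_trans)
    qed
    have mono: "m i < m j" if "i \<in> {1..k}" "j \<in> {1..k}" "i < j" for i j
      using yless[OF that] mem that by (auto simp: set_less_def)
    have inj: "inj_on m {1..k}"
      using mono by (intro inj_onI) (metis less_irrefl linorder_neqE_nat)
    \<comment> \<open>The blocks are renumbered by the minima of their supports, so that block j
      begins exactly at index j, the position of its coefficient.\<close>
    define \<iota> where "\<iota> = the_inv_into {1..k} m"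
    have \<iota>: "\<iota> (m i) = i" if "i \<in> {1..k}" for i
      unfolding \<iota>_def by (rule the_inv_into_f_f[OF inj that])
    define a where "a j = (\<Sum>i=1..k. norm (y i) * unit_vec (m i) j)" for j
    have a_m: "a (m i) = norm (y i)" if i: "i \<in> {1..k}" for i
    proof -
      have "a (m i) = (\<Sum>j=1..k. if j = i then norm (y i) else 0)"
        unfolding a_def by (intro sum.cong) (auto simp: unit_vec_def inj_on_eq_iff[OF inj i])
      then show ?thesis using i by simp
    qed
    have a_out: "a j = 0" if "j \<notin> m ` {1..k}" for j
      unfolding a_def using that by (intro sum.neutral) (auto simp: unit_vec_def)
    have a_sub: "{j. a j \<noteq> 0} \<subseteq> m ` {1..k}" using a_out by blast
    have m1: "m ` {1..k} \<subseteq> {1..}" using mem(1) ys(2) by blast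
    then have "a 0 = 0" by (intro a_out) auto
    then have a: "a \<in> c00" using finite_subset[OF a_sub] by (simp add: c00_def)
    have "1 / 2 * (1 - 3 * e) * N a \<le> norm (\<Sum>j\<in>m ` {1..k}. y (\<iota> j))"
    proof (rule lower[OF _ m1, where R = "\<lambda>j. supp x (y (\<iota> j))"])
      fix i assume "i \<in> m ` {1..k}"
      then obtain p where p: "p \<in> {1..k}" "i = m p" by blast
      then show "y (\<iota> i) \<in> span (x ` supp x (y (\<iota> i)))" "finite (supp x (y (\<iota> i)))"
        "supp x (y (\<iota> i)) \<subseteq> {i..}" "\<bar>a i\<bar> \<le> norm (y (\<iota> i))"
        using ys[OF p(1)] mem[OF p(1)] \<iota>[OF p(1)] a_m[OF p(1)] by auto
      fix j assume "j \<in> m ` {1..k}" "i < j"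
      then obtain q where q: "q \<in> {1..k}" "j = m q" "m p < m q" using p(2) by blast
      have "p < q" using mono[OF q(1) p(1)] q(3) by (metis less_asym linorder_neqE_nat)
      then show "set_less (supp x (y (\<iota> i))) (supp x (y (\<iota> j)))"
        using yless[OF p(1) q(1)] \<iota>[OF p(1)] \<iota>[OF q(1)] p(2) q(2) by simp
    qed (use a a_sub in auto)
    also have "(\<Sum>j\<in>m ` {1..k}. y (\<iota> j)) = (\<Sum>i=1..k. y i)"
      unfolding sum.reindex[OF inj] by (intro sum.cong) (auto simp: \<iota>)
    finally show ?thesis using weaken[OF a] unfolding a_def by linarith
  qed
  show "\<exists>x. block_basis z x \<and> (\<forall>i\<ge>1. norm (x i) = 1) \<and>
    (\<forall>a\<in>c00. norm (\<Sum>i | a i \<noteq> 0. a i *\<^sub>R x i) \<ge>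
        1 / 2 * (1 - \<epsilon>) * tsirelson_norm (\<gamma> 1) (\<lambda>j. \<Sum>i | a i \<noteq> 0. a i * unit_vec i j)) \<and>
    (\<forall>k y m. block_on x {1..k} y \<and> (\<forall>i\<in>{1..k}. m i = Min (supp x (y i))) \<longrightarrow>
        norm (\<Sum>i=1..k. y i) \<ge>
        1 / 2 * (1 - \<epsilon>) * tsirelson_norm (\<gamma> 1) (\<lambda>j. \<Sum>i=1..k. norm (y i) * unit_vec (m i) j))"
    using bx x(1) part1 part2 unfolding N_def \<theta>_def by (intro exI[of _ x] conjI ballI allI impI) blast+
qed

end
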